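(* Let $V$ be a general renormalizable three-Higgs-doublet potential, written in bilinear form as $V = M_0 r_0 + M_i r_i + \Lambda_0 r_0^2 + L_i r_0 r_i + \Lambda_{ij} r_i r_j$ with $M, L\in\mathbb{R}^8$ and $\Lambda$ a real symmetric $8\times 8$ matrix, and let $K^{(n)}_i=d_{ijk}(\Lambda^n)_{jk}$. Suppose that at least one of the vectors $M$, $L$, $K^{(n)}$ ($1\le n\le 7$) is nonzero and that these vectors respect complete alignment, i.e. the nonzero ones among them are all parallel to each other, they are self-aligned, and their common direction is an eigenvector of $\Lambda$. Suppose in addition that $\Lambda$ has four non-degenerate eigenvalues (four distinct eigenvalues of multiplicity one). Then the model has a CP4 symmetry.
   Context: Setting. There are three Higgs doublets $\phi_a\in\mathbb{C}^2$, $a=1,2,3$, and the (real-valued) potential is $V=Y_{ab}(\phi_a^\dagger\phi_b)+Z_{abcd}(\phi_a^\dagger\phi_b)(\phi_c^\dagger\phi_d)$ (repeated indices summed). Let $t_i=\lambda_i/2$, $i=1,\dots,8$, with $\lambda_i$ the standard Gell-Mann matrices. The tensors $f_{ijk}$ (totally antisymmetric) and $d_{ijk}$ (totally symmetric) are defined by $[t_i,t_j]=i f_{ijk}t_k$ and $\{t_i,t_j\}=\frac13\delta_{ij}\mathbf{1}_3+d_{ijk}t_k$. The bilinears are $r_0=\frac{1}{\sqrt3}\phi_a^\dagger\phi_a$ and $r_i=\phi_a^\dagger(t_i)_{ab}\phi_b$. Every potential $V$ can be written uniquely as $V = M_0 r_0 + M_i r_i + \Lambda_0 r_0^2 + L_i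 r_0 r_i + \Lambda_{ij} r_i r_j$ with real coefficients and $\Lambda_{ij}=\Lambda_{ji}$. Self-alignment. A nonzero vector $a\in\mathbb{R}^8$ is self-aligned if the vector with components $d_{ijk}a_ja_k$ is parallel to $a$. CP symmetries. A (generalized) $CP$ transformation is a map $\phi_a\mapsto X_{ab}\phi_b^*$ with $X$ a unitary $3\times3$ matrix ($*$ is componentwise complex conjugation of the doublets; the space-time argument is suppressed). It is a symmetry of $V$ if $V$ is invariant under it. Applying it twice gives the transformation $\phi_a\mapsto (XX^* )_{ab}\phi_b$. Under a unitary basis change $\phi\mapsto U\phi$ the matrix $X$ becomes $UXU^{T}$. The $CP$ transformation has order 4 (is a CP4) if $XX^*\neq\mathbf 1$ and $(XX^* )^2=\mathbf 1$; equivalently, there is a basis in which $X=\begin{pmatrix}0&1&0\\-1&0&0\\0&0&1\end{pmatrix}$. *)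

theory Defs
  imports "HOL-Analysis.Analysis"
begin

section \<open>Gell-Mann matrices and the tensor \<open>d\<close>\<close>

text \<open>In the index type \<^typ>\<open>8\<close> the numeral 8 equals 0; \<^const>\<open>vector\<close> places the
  first list entry at index 1 and the eighth one at index 8.\<close>

definition gell_mann :: "8 \<Rightarrow> complex^3^3" where
  "gell_mann i = (vector
     [vector [vector [0, 1, 0], vector [1, 0, 0], vector [0, 0, 0]],
      vector [vector [0, - \<i>, 0], vector [\<i>, 0, 0], vector [0, 0, 0]],
      vector [vector [1, 0, 0], vector [0, - 1, 0], vector [0, 0, 0]],
      vector [vector [0, 0, 1], vector [0, 0, 0], vector [1, 0, 0]],
      vector [vector [0, 0, - \<i>], vector [0, 0, 0], vector [\<i>, 0, 0]],
      vector [vector [0, 0, 0], vector [0, 0, 1], vector [0, 1, 0]],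
      vector [vector [0, 0, 0], vector [0, 0, - \<i>], vector [0, \<i>, 0]],
      (1 / sqrt 3) *\<^sub>R vector [vector [1, 0, 0], vector [0, 1, 0], vector [0, 0, - 2]]]
     :: complex^3^3^8) $ i"

definition su3_gen :: "8 \<Rightarrow> complex^3^3" where
  "su3_gen i = (1 / 2) *\<^sub>R gell_mann i"

definition is_d_tensor :: "(8 \<Rightarrow> 8 \<Rightarrow> 8 \<Rightarrow> real) \<Rightarrow> bool" where
  "is_d_tensor d \<longleftrightarrow>
     (\<forall>i j. su3_gen i ** su3_gen j + su3_gen j ** su3_gen i
        = (if i = j then 1 / 3 else 0) *\<^sub>R mat 1 + (\<Sum>k\<in>UNIV. d i j k *\<^sub>R su3_gen k))"

definition d_tensor :: "8 \<Rightarrow> 8 \<Rightarrow> 8 \<Rightarrow> real" where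
  "d_tensor = (THE d. is_d_tensor d)"


section \<open>Higgs potentials\<close>

text \<open>A field configuration \<open>\<phi>\<close> consists of three doublets; \<open>\<phi> $ a $ \<alpha>\<close> is the component \<open>\<alpha>\<close> of
  the doublet \<open>a\<close>.\<close>

type_synonym higgs_fields = "complex^2^3"

text \<open>\<open>dag_prod \<phi> a b\<close> is $\phi_a^\dagger \phi_b$.\<close>

definition dag_prod :: "higgs_fields \<Rightarrow> 3 \<Rightarrow> 3 \<Rightarrow> complex" where
  "dag_prod \<phi> a b = (\<Sum>\<alpha>\<in>UNIV. cnj (\<phi> $ a $ \<alpha>) * \<phi> $ b $ \<alpha>)"

definition is_3hdm_potential :: "(higgs_fields \<Rightarrow> real) \<Rightarrow> bool" where
  "is_3hdm_potential V \<longleftrightarrow>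
     (\<exists>(Y :: 3 \<Rightarrow> 3 \<Rightarrow> complex) (Z :: 3 \<Rightarrow> 3 \<Rightarrow> 3 \<Rightarrow> 3 \<Rightarrow> complex). \<forall>\<phi>.
        complex_of_real (V \<phi>) =
          (\<Sum>a\<in>UNIV. \<Sum>b\<in>UNIV. Y a b * dag_prod \<phi> a b)
        + (\<Sum>a\<in>UNIV. \<Sum>b\<in>UNIV. \<Sum>c\<in>UNIV. \<Sum>d\<in>UNIV.
             Z a b c d * dag_prod \<phi> a b * dag_prod \<phi> c d))"

text \<open>The sums under \<^const>\<open>Re\<close> are real: see \<open>of_real_bilinear0\<close> and \<open>of_real_bilinear\<close> below.\<close>

definition bilinear0 :: "higgs_fields \<Rightarrow> real" where
  "bilinear0 \<phi> = (1 / sqrt 3) * Re (\<Sum>a\<in>UNIV. dag_prod \<phi> a a)"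

definition bilinear :: "higgs_fields \<Rightarrow> real^8" where
  "bilinear \<phi> = (\<chi> i. Re (\<Sum>a\<in>UNIV. \<Sum>b\<in>UNIV. su3_gen i $ a $ b * dag_prod \<phi> a b))"

definition bilinear_potential ::
  "real \<Rightarrow> real^8 \<Rightarrow> real \<Rightarrow> real^8 \<Rightarrow> real^8^8 \<Rightarrow> higgs_fields \<Rightarrow> real" where
  "bilinear_potential M0 M \<Lambda>0 L \<Lambda> \<phi> =
     M0 * bilinear0 \<phi> + (\<Sum>i\<in>UNIV. M $ i * bilinear \<phi> $ i)
     + \<Lambda>0 * (bilinear0 \<phi>)\<^sup>2 + (\<Sum>i\<in>UNIV. L $ i * bilinear0 \<phi> * bilinear \<phi> $ i)
     + (\<Sum>i\<in>UNIV. \<Sum>j\<in>UNIV. \<Lambda> $ i $ j * bilinear \<phi> $ i * bilinear \<phi> $ j)"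


section \<open>Alignment\<close>

text \<open>The library's \<open>^\<close> on \<^typ>\<open>real^8^8\<close> is componentwise, hence the explicit iteration of the
  matrix product.\<close>

definition mat_pow :: "real^8^8 \<Rightarrow> nat \<Rightarrow> real^8^8" where
  "mat_pow A n = (((**) A) ^^ n) (mat 1)"

definition K_vec :: "real^8^8 \<Rightarrow> nat \<Rightarrow> real^8" where
  "K_vec \<Lambda> n = (\<chi> i. \<Sum>j\<in>UNIV. \<Sum>k\<in>UNIV. d_tensor i j k * mat_pow \<Lambda> n $ j $ k)"

text \<open>Parallel vectors may point in opposite directions.\<close>

definition parallel :: "real^8 \<Rightarrow> real^8 \<Rightarrow> bool" where
  "parallel u v \<longleftrightarrow> collinear {0, u, v}"

definition self_aligned :: "real^8 \<Rightarrow> bool" where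
  "self_aligned a \<longleftrightarrow>
     a \<noteq> 0 \<and> parallel (\<chi> i. \<Sum>j\<in>UNIV. \<Sum>k\<in>UNIV. d_tensor i j k * a $ j * a $ k) a"

definition alignment_vectors :: "real^8 \<Rightarrow> real^8 \<Rightarrow> real^8^8 \<Rightarrow> (real^8) set" where
  "alignment_vectors M L \<Lambda> = {M, L} \<union> K_vec \<Lambda> ` {1..7}"

definition complete_alignment :: "real^8 \<Rightarrow> real^8 \<Rightarrow> real^8^8 \<Rightarrow> bool" where
  "complete_alignment M L \<Lambda> \<longleftrightarrow>
     (\<forall>u\<in>alignment_vectors M L \<Lambda>. \<forall>v\<in>alignment_vectors M L \<Lambda>.
        u \<noteq> 0 \<longrightarrow> v \<noteq> 0 \<longrightarrow> parallel u v) \<and>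
     (\<forall>v\<in>alignment_vectors M L \<Lambda>.
        v \<noteq> 0 \<longrightarrow> self_aligned v \<and> (\<exists>c. \<Lambda> *v v = c *\<^sub>R v))"

text \<open>For symmetric matrices, geometric and algebraic multiplicities agree.\<close>

definition nondegenerate_eigenvalues :: "real^8^8 \<Rightarrow> real set" where
  "nondegenerate_eigenvalues \<Lambda> = {x. dim {v. \<Lambda> *v v = x *\<^sub>R v} = 1}"


section \<open>CP transformations\<close>

definition conj_mat :: "complex^3^3 \<Rightarrow> complex^3^3" where
  "conj_mat X = (\<chi> i j. cnj (X $ i $ j))"

definition unitary_mat :: "complex^3^3 \<Rightarrow> bool" where
  "unitary_mat X \<longleftrightarrow>
     transpose (conj_mat X) ** X = mat 1 \<and> X ** transpose (conj_mat X) = mat 1"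

definition cp_map :: "complex^3^3 \<Rightarrow> higgs_fields \<Rightarrow> higgs_fields" where
  "cp_map X \<phi> = (\<chi> a \<alpha>. \<Sum>b\<in>UNIV. X $ a $ b * cnj (\<phi> $ b $ \<alpha>))"

definition cp_symmetry :: "(higgs_fields \<Rightarrow> real) \<Rightarrow> complex^3^3 \<Rightarrow> bool" where
  "cp_symmetry V X \<longleftrightarrow> unitary_mat X \<and> (\<forall>\<phi>. V (cp_map X \<phi>) = V \<phi>)"

definition cp_order4 :: "complex^3^3 \<Rightarrow> bool" where
  "cp_order4 X \<longleftrightarrow>
     X ** conj_mat X \<noteq> mat 1 \<and> (X ** conj_mat X) ** (X ** conj_mat X) = mat 1"

definition has_CP4 :: "(higgs_fields \<Rightarrow> real) \<Rightarrow> bool" where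
  "has_CP4 V \<longleftrightarrow> (\<exists>X. cp_symmetry V X \<and> cp_order4 X)"


section \<open>Sanity checks\<close>

lemma UNIV_8: "(UNIV :: 8 set) = {1, 2, 3, 4, 5, 6, 7, 8}"
proof -
  have "card {1, 2, 3, 4, 5, 6, 7, 8 :: 8} = 8" by simp
  then show ?thesis by (intro card_subset_eq[symmetric]) auto
qed

lemma sum_8: "sum f (UNIV :: 8 set) = f 1 + f 2 + f 3 + f 4 + f 5 + f 6 + f 7 + f 8"
  unfolding UNIV_8 by (simp add: ac_simps)

lemma forall_8: "(\<forall>i::8. P i) \<longleftrightarrow> P 1 \<and> P 2 \<and> P 3 \<and> P 4 \<and> P 5 \<and> P 6 \<and> P 7 \<and> P 8"
proof -
  have "(\<forall>i::8. P i) \<longleftrightarrow> (\<forall>i\<in>UNIV. P i)" by simp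
  then show ?thesis unfolding UNIV_8 by simp
qed

lemma gell_mann_simps:
  "gell_mann 1 = vector [vector [0, 1, 0], vector [1, 0, 0], vector [0, 0, 0]]"
  "gell_mann 2 = vector [vector [0, - \<i>, 0], vector [\<i>, 0, 0], vector [0, 0, 0]]"
  "gell_mann 3 = vector [vector [1, 0, 0], vector [0, - 1, 0], vector [0, 0, 0]]"
  "gell_mann 4 = vector [vector [0, 0, 1], vector [0, 0, 0], vector [1, 0, 0]]"
  "gell_mann 5 = vector [vector [0, 0, - \<i>], vector [0, 0, 0], vector [\<i>, 0, 0]]"
  "gell_mann 6 = vector [vector [0, 0, 0], vector [0, 0, 1], vector [0, 1, 0]]"
  "gell_mann 7 = vector [vector [0, 0, 0], vector [0, 0, - \<i>], vector [0, \<i>, 0]]"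
  "gell_mann 8 = (1 / sqrt 3) *\<^sub>R vector [vector [1, 0, 0], vector [0, 1, 0], vector [0, 0, - 2]]"
  unfolding gell_mann_def vector_def[where 'a = "complex^3^3"] by simp_all

lemma su3_gen_hermitian: "cnj (su3_gen i $ a $ b) = su3_gen i $ b $ a"
proof -
  have "\<forall>i a b. cnj (su3_gen i $ a $ b) = su3_gen i $ b $ a"
    unfolding forall_8 forall_3 by (simp add: su3_gen_def gell_mann_simps)
  then show ?thesis by blast
qed

lemma trace_su3_gen_mult: "trace (su3_gen i ** su3_gen j) = (if i = j then 1 / 2 else 0)"
proof -
  have *: "complex_of_real (sqrt 3) * complex_of_real (sqrt 3) = 3"
    by (simp flip: of_real_mult)
  have "\<forall>i j. trace (su3_gen i ** su3_gen j) = (if i = j then 1 / 2 else 0)"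
    unfolding forall_8
    by (simp add: su3_gen_def gell_mann_simps trace_def matrix_matrix_mult_def sum_3
        scaleR_conv_of_real[where 'a = complex] field_simps *)
  then show ?thesis by blast
qed

lemma trace_su3_gen: "trace (su3_gen i) = 0"
proof -
  have "\<forall>i. trace (su3_gen i) = 0"
    unfolding forall_8 by (simp add: su3_gen_def gell_mann_simps trace_def sum_3)
  then show ?thesis by blast
qed

lemma trace_scaleR: "trace (c *\<^sub>R A) = c *\<^sub>R trace (A :: complex^3^3)"
  by (simp add: trace_def scaleR_sum_right)

lemma trace_sum: "trace (\<Sum>k\<in>S. A k) = (\<Sum>k\<in>S. trace (A k :: complex^3^3))"
  by (simp add: trace_def sum.swap[of _ S])

lemma scaleR_matrix_mult: "(c *\<^sub>R A) ** B = c *\<^sub>R (A ** (B :: complex^3^3))"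
  by (simp add: matrix_matrix_mult_def vec_eq_iff scaleR_sum_right)

lemma matrix_mult_add_left: "(A + C) ** B = A ** B + C ** (B :: complex^3^3)"
  by (simp add: matrix_matrix_mult_def vec_eq_iff distrib_right sum.distrib)

lemma sum_matrix_mult: "(\<Sum>k\<in>S. A k) ** B = (\<Sum>k\<in>S. A k ** (B :: complex^3^3))"
  by (simp add: matrix_matrix_mult_def vec_eq_iff sum_distrib_right sum.swap[of _ S])

lemma hermitian_expansion:
  fixes H :: "complex^3^3"
  assumes herm: "\<And>a b. cnj (H $ a $ b) = H $ b $ a"
  shows "H = (Re (trace H) / 3) *\<^sub>R mat 1
    + (\<Sum>k\<in>UNIV. (2 * Re (trace (H ** su3_gen k))) *\<^sub>R su3_gen k)"
proof -
  have s3: "sqrt 3 * sqrt 3 = 3" by simp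
  have re: "Re (H $ b $ a) = Re (H $ a $ b)" and im: "Im (H $ b $ a) = - Im (H $ a $ b)" for a b
    by (simp_all flip: herm[of a b])
  have im0: "Im (H $ a $ a) = 0" for a using im[of a a] by simp
  note r = re[of 2 1] re[of 3 1] re[of 3 2] im[of 2 1] im[of 3 1] im[of 3 2] im0
  show ?thesis
    unfolding vec_eq_iff forall_3 sum_8
    by (simp add: su3_gen_def gell_mann_simps trace_def matrix_matrix_mult_def sum_3 mat_def
        complex_eq_iff r field_simps s3)
qed

lemma is_d_tensor_trace:
  "is_d_tensor (\<lambda>i j k.
     2 * Re (trace ((su3_gen i ** su3_gen j + su3_gen j ** su3_gen i) ** su3_gen k)))"
  unfolding is_d_tensor_def
proof (intro allI)
  fix i j
  define H where "H = su3_gen i ** su3_gen j + su3_gen j ** su3_gen i"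
  have "cnj (H $ a $ b) = H $ b $ a" for a b
    by (simp add: H_def matrix_matrix_mult_def su3_gen_hermitian mult.commute add.commute)
  from hermitian_expansion[OF this]
  show "su3_gen i ** su3_gen j + su3_gen j ** su3_gen i
        = (if i = j then 1 / 3 else 0) *\<^sub>R mat 1 + (\<Sum>k\<in>UNIV. (2 * Re (trace
          ((su3_gen i ** su3_gen j + su3_gen j ** su3_gen i) ** su3_gen k))) *\<^sub>R su3_gen k)"
    by (simp add: H_def trace_add trace_su3_gen_mult split: if_splits)
qed

lemma is_d_tensor_unique:
  assumes "is_d_tensor d"
  shows "d i j l =
     2 * Re (trace ((su3_gen i ** su3_gen j + su3_gen j ** su3_gen i) ** su3_gen l))"
proof -
  have "su3_gen i ** su3_gen j + su3_gen j ** su3_gen i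
     = (if i = j then 1 / 3 else 0) *\<^sub>R mat 1 + (\<Sum>k\<in>UNIV. d i j k *\<^sub>R su3_gen k)"
    using assms unfolding is_d_tensor_def by blast
  then have "trace ((su3_gen i ** su3_gen j + su3_gen j ** su3_gen i) ** su3_gen l)
     = (\<Sum>k\<in>UNIV. d i j k *\<^sub>R (if k = l then 1 / 2 else 0))"
    by (simp only: matrix_mult_add_left scaleR_matrix_mult sum_matrix_mult trace_add trace_scaleR
        trace_sum matrix_mul_lid trace_su3_gen trace_su3_gen_mult scaleR_zero_right add_0_left)
  also have "\<dots> = (\<Sum>k\<in>UNIV. if k = l then complex_of_real (d i j l / 2) else 0)"
    by (intro sum.cong) (auto simp: scaleR_conv_of_real)
  also have "\<dots> = complex_of_real (d i j l / 2)" by simp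
  finally show ?thesis by (simp only: Re_complex_of_real)
qed

lemma is_d_tensor_iff: "is_d_tensor d \<longleftrightarrow> d = d_tensor"
proof -
  let ?d = "\<lambda>i j k.
     2 * Re (trace ((su3_gen i ** su3_gen j + su3_gen j ** su3_gen i) ** su3_gen k))"
  have u: "d = ?d" if "is_d_tensor d" for d
    by (intro ext is_d_tensor_unique[OF that])
  have "d_tensor = ?d"
    unfolding d_tensor_def using is_d_tensor_trace u by (rule the_equality)
  show ?thesis
  proof
    assume "is_d_tensor d"
    then have "d = ?d" by (rule u)
    also have "\<dots> = d_tensor" by (rule \<open>d_tensor = ?d\<close>[symmetric])
    finally show "d = d_tensor" .
  next
    assume "d = d_tensor"
    then have "d = ?d" using \<open>d_tensor = ?d\<close> by (rule trans)
    with is_d_tensor_trace show "is_d_tensor d" by (simp only:)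
  qed
qed

lemma d_tensor_trace: "d_tensor i j k =
     2 * Re (trace ((su3_gen i ** su3_gen j + su3_gen j ** su3_gen i) ** su3_gen k))"
  by (rule is_d_tensor_unique) (simp only: is_d_tensor_iff)

lemma cnj_dag_prod: "cnj (dag_prod \<phi> a b) = dag_prod \<phi> b a"
  by (simp add: dag_prod_def mult.commute)

lemma of_real_bilinear0:
  "complex_of_real (bilinear0 \<phi>) = complex_of_real (1 / sqrt 3) * (\<Sum>a\<in>UNIV. dag_prod \<phi> a a)"
proof -
  have "(\<Sum>a\<in>UNIV. dag_prod \<phi> a a) \<in> \<real>"
    by (simp add: Reals_cnj_iff cnj_dag_prod)
  then show ?thesis by (simp only: bilinear0_def of_real_mult of_real_Re)
qed

lemma of_real_bilinear:
  "complex_of_real (bilinear \<phi> $ i) = (\<Sum>a\<in>UNIV. \<Sum>b\<in>UNIV. su3_gen i $ a $ b * dag_prod \<phi> a b)"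
proof -
  have "cnj (\<Sum>a\<in>UNIV. \<Sum>b\<in>UNIV. su3_gen i $ a $ b * dag_prod \<phi> a b)
     = (\<Sum>a\<in>UNIV. \<Sum>b\<in>UNIV. su3_gen i $ b $ a * dag_prod \<phi> b a)"
    by (simp add: su3_gen_hermitian cnj_dag_prod)
  also have "\<dots> = (\<Sum>a\<in>UNIV. \<Sum>b\<in>UNIV. su3_gen i $ a $ b * dag_prod \<phi> a b)"
    by (rule sum.swap)
  finally have "(\<Sum>a\<in>UNIV. \<Sum>b\<in>UNIV. su3_gen i $ a $ b * dag_prod \<phi> a b) \<in> \<real>"
    by (simp only: Reals_cnj_iff)
  then show ?thesis by (simp only: bilinear_def vec_lambda_beta of_real_Re)
qed

lemma is_3hdm_potential_add:
  assumes "is_3hdm_potential V" "is_3hdm_potential W"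
  shows "is_3hdm_potential (\<lambda>\<phi>. V \<phi> + W \<phi>)"
proof -
  obtain Y Z where V: "\<And>\<phi>. complex_of_real (V \<phi>) =
          (\<Sum>a\<in>UNIV. \<Sum>b\<in>UNIV. Y a b * dag_prod \<phi> a b)
        + (\<Sum>a\<in>UNIV. \<Sum>b\<in>UNIV. \<Sum>c\<in>UNIV. \<Sum>d\<in>UNIV.
             Z a b c d * dag_prod \<phi> a b * dag_prod \<phi> c d)"
    using assms(1) unfolding is_3hdm_potential_def by blast
  obtain Y' Z' where W: "\<And>\<phi>. complex_of_real (W \<phi>) =
          (\<Sum>a\<in>UNIV. \<Sum>b\<in>UNIV. Y' a b * dag_prod \<phi> a b)
        + (\<Sum>a\<in>UNIV. \<Sum>b\<in>UNIV. \<Sum>c\<in>UNIV. \<Sum>d\<in>UNIV.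
             Z' a b c d * dag_prod \<phi> a b * dag_prod \<phi> c d)"
    using assms(2) unfolding is_3hdm_potential_def by blast
  show ?thesis
    unfolding is_3hdm_potential_def
    by (rule exI[of _ "\<lambda>a b. Y a b + Y' a b"], rule exI[of _ "\<lambda>a b c d. Z a b c d + Z' a b c d"])
      (simp add: V W distrib_right sum.distrib)
qed

lemma is_3hdm_potential_cmult:
  assumes "is_3hdm_potential V"
  shows "is_3hdm_potential (\<lambda>\<phi>. c * V \<phi>)"
proof -
  obtain Y Z where V: "\<And>\<phi>. complex_of_real (V \<phi>) =
          (\<Sum>a\<in>UNIV. \<Sum>b\<in>UNIV. Y a b * dag_prod \<phi> a b)
        + (\<Sum>a\<in>UNIV. \<Sum>b\<in>UNIV. \<Sum>c\<in>UNIV. \<Sum>d\<in>UNIV.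
             Z a b c d * dag_prod \<phi> a b * dag_prod \<phi> c d)"
    using assms(1) unfolding is_3hdm_potential_def by blast
  show ?thesis
    unfolding is_3hdm_potential_def
    by (rule exI[of _ "\<lambda>a b. complex_of_real c * Y a b"],
        rule exI[of _ "\<lambda>a b e d. complex_of_real c * Z a b e d"])
      (simp add: V distrib_left sum_distrib_left mult.assoc)
qed

lemma is_3hdm_potential_sum:
  assumes "finite S" "\<And>i. i \<in> S \<Longrightarrow> is_3hdm_potential (V i)"
  shows "is_3hdm_potential (\<lambda>\<phi>. \<Sum>i\<in>S. V i \<phi>)"
  using assms
proof (induction S)
  case empty
  show ?case
    unfolding is_3hdm_potential_def
    by (rule exI[of _ "\<lambda>a b. 0"], rule exI[of _ "\<lambda>a b c d. 0"]) simp
next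
  case (insert i S)
  then show ?case by (simp add: is_3hdm_potential_add)
qed

lemma is_3hdm_potential_hermitian_form:
  assumes "\<And>\<phi>. complex_of_real (f \<phi>) = (\<Sum>a\<in>UNIV. \<Sum>b\<in>UNIV. A a b * dag_prod \<phi> a b)"
  shows "is_3hdm_potential f"
  unfolding is_3hdm_potential_def
  by (rule exI[of _ A], rule exI[of _ "\<lambda>a b c d. 0"]) (simp add: assms)

lemma is_3hdm_potential_mult:
  assumes f: "\<And>\<phi>. complex_of_real (f \<phi>) = (\<Sum>a\<in>UNIV. \<Sum>b\<in>UNIV. A a b * dag_prod \<phi> a b)"
    and g: "\<And>\<phi>. complex_of_real (g \<phi>) = (\<Sum>a\<in>UNIV. \<Sum>b\<in>UNIV. B a b * dag_prod \<phi> a b)"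
  shows "is_3hdm_potential (\<lambda>\<phi>. f \<phi> * g \<phi>)"
proof -
  have "complex_of_real (f \<phi> * g \<phi>) = (\<Sum>a\<in>UNIV. \<Sum>b\<in>UNIV. \<Sum>c\<in>UNIV. \<Sum>d\<in>UNIV.
             (A a b * B c d) * dag_prod \<phi> a b * dag_prod \<phi> c d)" for \<phi>
  proof -
    have "complex_of_real (f \<phi> * g \<phi>) = (\<Sum>a\<in>UNIV. \<Sum>b\<in>UNIV. A a b * dag_prod \<phi> a b *
        (\<Sum>c\<in>UNIV. \<Sum>d\<in>UNIV. B c d * dag_prod \<phi> c d))"
      by (simp only: of_real_mult f g sum_distrib_right)
    also have "\<dots> = (\<Sum>a\<in>UNIV. \<Sum>b\<in>UNIV. \<Sum>c\<in>UNIV. \<Sum>d\<in>UNIV.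
        (A a b * dag_prod \<phi> a b) * (B c d * dag_prod \<phi> c d))"
      by (simp only: sum_distrib_left)
    also have "\<dots> = (\<Sum>a\<in>UNIV. \<Sum>b\<in>UNIV. \<Sum>c\<in>UNIV. \<Sum>d\<in>UNIV.
        (A a b * B c d) * dag_prod \<phi> a b * dag_prod \<phi> c d)"
      by (intro sum.cong refl) (simp only: mult.assoc mult.left_commute)
    finally show ?thesis .
  qed
  then show ?thesis
    unfolding is_3hdm_potential_def
    by (intro exI[of _ "\<lambda>a b. 0"] exI[of _ "\<lambda>a b c d. A a b * B c d"] allI)
      (simp only: mult_zero_left sum.neutral_const add_0_left)
qed

lemma is_3hdm_potential_bilinear_potential:
  "is_3hdm_potential (bilinear_potential M0 M \<Lambda>0 L \<Lambda>)"
proof -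
  have f0: "complex_of_real (bilinear0 \<phi>)
      = (\<Sum>a\<in>UNIV. \<Sum>b\<in>UNIV. (if a = b then complex_of_real (1 / sqrt 3) else 0) * dag_prod \<phi> a b)"
    for \<phi>
    by (simp add: of_real_bilinear0 sum_3 forall_3 distrib_left)
  note h = is_3hdm_potential_hermitian_form[OF f0]
    is_3hdm_potential_hermitian_form[OF of_real_bilinear]
    is_3hdm_potential_mult[OF f0 f0] is_3hdm_potential_mult[OF f0 of_real_bilinear]
    is_3hdm_potential_mult[OF of_real_bilinear of_real_bilinear]
  show ?thesis
    unfolding bilinear_potential_def[abs_def] power2_eq_square mult.assoc
    by (intro is_3hdm_potential_add is_3hdm_potential_sum is_3hdm_potential_cmult h finite)
qed

end

theory Submission
  imports Defs
begin

text \<open>Identify \<open>x \<in> \<real>\<^sup>8\<close> with the traceless Hermitian matrix \<open>\<Sum>x\<^sub>i t\<^sub>i\<close>. Self-alignment of the common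
  direction says that its matrix satisfies a quadratic equation, so it is a multiple of
  \<open>1 - 3 e e\<^sup>*\<close>, and a unitary basis change turns the direction into the eighth axis.
  By interpolation in the powers of \<open>\<Lambda>\<close>, alignment of the \<open>K\<^sup>(\<^sup>n\<^sup>)\<close> means that, for every eigenvalue,
  the sum of the vectors \<open>d\<^sub>i\<^sub>j\<^sub>k b\<^sub>j b\<^sub>k\<close> over an orthonormal basis of the eigenspace is parallel to that
  axis. For a nondegenerate eigenvector orthogonal to the axis this forces it into the span of the
  first three axes, so the four nondegenerate eigenvectors span axes 1, 2, 3 and 8. On axes 4 to 7,
  that is on \<open>\<complex>\<^sup>2\<close>, every eigenvalue is then degenerate; if there are two, the condition says
  that an orthonormal basis of an eigenplane is a unitary basis of \<open>\<complex>\<^sup>2\<close>, and the antiunitary map that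
  sends its first member to the second and the second to minus the first provides the CP4
  transformation.\<close>

section \<open>Spectral theorem\<close>

text \<open>Maximise the quadratic form of \<open>f\<close> on the unit sphere of \<open>S\<close>.
  For the maximum \<open>c\<close>, attained at \<open>v\<close>, the form of
  \<open>c id - f\<close> is positive semidefinite on \<open>S\<close> and vanishes at
  \<open>v\<close>, which forces \<open>f v = c v\<close>.\<close>

lemma self_adjoint_eigenvector_exists:
  fixes f :: "'a::euclidean_space \<Rightarrow> 'a"
  assumes lin: "linear f" and sa: "\<And>x y. f x \<bullet> y = x \<bullet> f y"
    and S: "subspace S" "S \<noteq> {0}" and inv: "f ` S \<subseteq> S"
  obtains v c where "v \<in> S" "norm v = 1" "f v = c *\<^sub>R v"
proof -
  have "compact (S \<inter> sphere 0 1)"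
    using closed_subspace[OF S(1)] by (simp add: closed_Int_compact)
  moreover obtain x where "x \<in> S" "x \<noteq> 0"
    using S subspace_0 by blast
  then have "x /\<^sub>R norm x \<in> S \<inter> sphere 0 1"
    using S(1) by (simp add: subspace_scale)
  then have "S \<inter> sphere 0 1 \<noteq> {}" by blast
  moreover have "continuous_on (S \<inter> sphere 0 1) (\<lambda>x. x \<bullet> f x)"
    by (intro continuous_intros linear_continuous_on linear_conv_bounded_linear[THEN iffD1] lin)
  ultimately obtain v where v: "v \<in> S" "norm v = 1"
    and max: "\<And>y. y \<in> S \<Longrightarrow> norm y = 1 \<Longrightarrow> y \<bullet> f y \<le> v \<bullet> f v"
    using continuous_attains_sup[of "S \<inter> sphere 0 1" "\<lambda>x. x \<bullet> f x"]
    by (metis IntE IntI mem_sphere_0)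
  define c where "c = v \<bullet> f v"
  define g where "g x = c *\<^sub>R x - f x" for x
  have gS: "g x \<in> S" if "x \<in> S" for x
    using that inv S(1) by (auto simp: g_def intro!: subspace_diff subspace_scale)
  have psd: "x \<bullet> g x \<ge> 0" if "x \<in> S" for x
  proof (cases "x = 0")
    case False
    have "(x /\<^sub>R norm x) \<bullet> f (x /\<^sub>R norm x) \<le> c"
      unfolding c_def using False that S(1) by (intro max) (auto intro: subspace_scale)
    then have "x \<bullet> f x \<le> c * (norm x)\<^sup>2"
      using False by (simp add: linear_scale[OF lin] field_simps power2_eq_square)
    then show ?thesis by (simp add: g_def inner_diff_right dot_square_norm)
  qed (simp add: g_def)
  define w where "w = g v"
  \<comment> \<open>Moving from \<open>v\<close> to \<open>v + t w\<close> changes the form of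
    \<open>g\<close> by \<open>-(w.w)^2 (w.gw + 2) / (w.gw + 1)^2\<close>, which is negative unless
    \<open>w = 0\<close>. The summand 1 keeps the denominator positive.\<close>
  define t where "t = - (w \<bullet> w) / (w \<bullet> g w + 1)"
  have w: "w \<in> S" using gS v by (simp add: w_def)
  have b: "w \<bullet> g w \<ge> 0" by (rule psd[OF w])
  have gt: "g (v + t *\<^sub>R w) = g v + t *\<^sub>R g w"
    by (simp add: g_def linear_add[OF lin] linear_scale[OF lin] algebra_simps)
  have vg: "v \<bullet> g v = 0"
    using v by (simp add: g_def inner_diff_right c_def dot_square_norm)
  have vgw: "v \<bullet> g w = w \<bullet> w"
    by (simp add: w_def g_def inner_diff_right inner_diff_left sa[symmetric] linear_diff[OF lin]
        linear_scale[OF lin])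
  have "0 \<le> (v + t *\<^sub>R w) \<bullet> g (v + t *\<^sub>R w)"
    by (intro psd subspace_add S(1) subspace_scale v w)
  also have "\<dots> = 2 * t * (w \<bullet> w) + t\<^sup>2 * (w \<bullet> g w)"
    unfolding gt w_def[symmetric] by (simp add: inner_add_left inner_add_right vgw vg[folded w_def]
        power2_eq_square algebra_simps)
  finally have "0 \<le> (2 * t * (w \<bullet> w) + t\<^sup>2 * (w \<bullet> g w)) * (w \<bullet> g w + 1)\<^sup>2"
    by (intro mult_nonneg_nonneg) auto
  also have "\<dots> = 2 * (w \<bullet> w) * (t * (w \<bullet> g w + 1)) * (w \<bullet> g w + 1)
      + (t * (w \<bullet> g w + 1))\<^sup>2 * (w \<bullet> g w)"
    by algebra
  also have "t * (w \<bullet> g w + 1) = - (w \<bullet> w)"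
    using b by (simp add: t_def)
  finally have "(w \<bullet> w)\<^sup>2 * (w \<bullet> g w + 2) \<le> 0"
    by (simp add: power2_eq_square algebra_simps)
  then have "w = 0" using b by (auto simp: mult_le_0_iff)
  then have "f v = c *\<^sub>R v" by (simp add: w_def g_def)
  then show thesis using v that by blast
qed

text \<open>Induction on the dimension: split off a unit eigenvector; self-adjointness makes its
  orthogonal complement in \<open>S\<close> invariant again. Arbitrary invariant subspaces are
  allowed so that the induction hypothesis applies to the complement.\<close>

theorem self_adjoint_orthonormal_eigenbasis:
  fixes f :: "'a::euclidean_space \<Rightarrow> 'a"
  assumes lin: "linear f" and sa: "\<And>x y. f x \<bullet> y = x \<bullet> f y"
    and "subspace S" and "f ` S \<subseteq> S"
  shows "\<exists>B. B \<subseteq> S \<and> pairwise orthogonal B \<and> (\<forall>b\<in>B. norm b = 1 \<and> (\<exists>c. f b = c *\<^sub>R b))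
    \<and> span B = S"
  using assms(3,4)
proof (induction "dim S" arbitrary: S rule: less_induct)
  case less
  show ?case
  proof (cases "S = {0}")
    case True
    then show ?thesis by (intro exI[of _ "{}"]) auto
  next
    case False
    obtain v c where v: "v \<in> S" "norm v = 1" "f v = c *\<^sub>R v"
      using self_adjoint_eigenvector_exists[OF lin sa less.prems(1) False less.prems(2)] .
    define T where "T = {x \<in> S. v \<bullet> x = 0}"
    have T: "subspace T"
      using less.prems(1) by (auto simp: T_def subspace_def inner_add_right)
    have "v \<notin> T" using v by (auto simp: T_def)
    moreover have "T \<subseteq> S" by (auto simp: T_def)
    ultimately have "T \<subset> S" using v(1) by blast
    then have "dim T < dim S"
      by (intro dim_psubset) (simp only: span_eq_iff[THEN iffD2, OF T]
          span_eq_iff[THEN iffD2, OF less.prems(1)])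
    moreover have "f ` T \<subseteq> T"
      using less.prems(2) v(3) by (auto simp: T_def simp flip: sa)
    ultimately obtain B where B: "B \<subseteq> T" "pairwise orthogonal B"
      "\<forall>b\<in>B. norm b = 1 \<and> (\<exists>c. f b = c *\<^sub>R b)" "span B = T"
      using less.hyps T by blast
    have "span (insert v B) = S"
    proof
      show "span (insert v B) \<subseteq> S"
        using B(1) v(1) less.prems(1) by (intro span_minimal) (auto simp: T_def)
      show "S \<subseteq> span (insert v B)"
      proof
        fix x assume "x \<in> S"
        then have "x - (v \<bullet> x) *\<^sub>R v \<in> T"
          using v less.prems(1)
          by (auto simp: T_def inner_diff_right dot_square_norm intro!: subspace_diff subspace_scale)
        then show "x \<in> span (insert v B)"
          unfolding span_insert B(4) by blast
      qed
    qed
    moreover have "pairwise orthogonal (insert v B)"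
      using B(1,2) by (auto simp: pairwise_insert T_def orthogonal_def inner_commute)
    ultimately show ?thesis
      using B v by (intro exI[of _ "insert v B"]) (auto simp: T_def)
  qed
qed

section \<open>Coordinates with respect to an orthonormal eigenbasis\<close>

locale orthonormal_eigenbasis =
  fixes A :: "real^'n^'n" and B :: "(real^'n) set" and ev :: "real^'n \<Rightarrow> real"
  assumes orthogonal_B: "pairwise orthogonal B"
    and norm_B: "b \<in> B \<Longrightarrow> norm b = 1"
    and span_B: "span B = UNIV"
    and ev: "b \<in> B \<Longrightarrow> A *v b = ev b *\<^sub>R b"
begin

lemma inner_B: "a \<in> B \<Longrightarrow> b \<in> B \<Longrightarrow> a \<bullet> b = (if a = b then 1 else 0)"
  using orthogonal_B norm_B by (auto simp: pairwise_def orthogonal_def dot_square_norm)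

lemma independent_B: "independent B"
  using orthogonal_B norm_B[of 0] by (intro pairwise_orthogonal_independent) auto

lemma finite_B: "finite B"
  using independent_B by (rule independent_imp_finite)

lemma card_B: "card B = CARD('n)"
  using independent_B span_B indep_card_eq_dim_span[OF independent_B] by simp

lemma eqI_B: "(\<And>b. b \<in> B \<Longrightarrow> x \<bullet> b = y \<bullet> b) \<Longrightarrow> x = y"
proof -
  assume *: "\<And>b. b \<in> B \<Longrightarrow> x \<bullet> b = y \<bullet> b"
  have "orthogonal (x - y) z" if "z \<in> span B" for z
  proof (rule orthogonal_to_span[OF that])
    fix b assume "b \<in> B"
    then show "orthogonal (x - y) b"
      using *[of b] by (simp add: orthogonal_def inner_diff_left)
  qed
  then have "orthogonal (x - y) (x - y)" using span_B by simp
  then show "x = y" by (simp add: orthogonal_def)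
qed

lemma expansion: "x = (\<Sum>b\<in>B. (x \<bullet> b) *\<^sub>R b)"
proof (rule eqI_B)
  fix b assume "b \<in> B"
  have "(\<Sum>b\<in>B. (x \<bullet> b) *\<^sub>R b) \<bullet> b = (\<Sum>a\<in>B. if a = b then x \<bullet> b else 0)"
    unfolding inner_sum_left using \<open>b \<in> B\<close> by (intro sum.cong) (auto simp: inner_B)
  also have "\<dots> = x \<bullet> b"
    using \<open>b \<in> B\<close> finite_B by simp
  finally show "x \<bullet> b = (\<Sum>b\<in>B. (x \<bullet> b) *\<^sub>R b) \<bullet> b" by simp
qed

lemma inner_mult_vec: "b \<in> B \<Longrightarrow> (A *v x) \<bullet> b = ev b * (x \<bullet> b)"
proof -
  assume b: "b \<in> B"
  have "A *v x = (\<Sum>a\<in>B. (x \<bullet> a) *\<^sub>R (A *v a))"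
    by (subst expansion[of x])
      (simp only: linear_sum[OF matrix_vector_mul_linear] matrix_vector_mult_scaleR)
  then have "(A *v x) \<bullet> b = (\<Sum>a\<in>B. if a = b then ev b * (x \<bullet> b) else 0)"
    using b by (auto simp: inner_sum_left ev inner_B intro!: sum.cong)
  then show ?thesis using b finite_B by simp
qed

lemma eigenvector_iff: "A *v x = \<mu> *\<^sub>R x \<longleftrightarrow> (\<forall>b\<in>B. ev b \<noteq> \<mu> \<longrightarrow> x \<bullet> b = 0)"
proof
  assume "A *v x = \<mu> *\<^sub>R x"
  then show "\<forall>b\<in>B. ev b \<noteq> \<mu> \<longrightarrow> x \<bullet> b = 0"
    using inner_mult_vec[of _ x] by auto
next
  assume "\<forall>b\<in>B. ev b \<noteq> \<mu> \<longrightarrow> x \<bullet> b = 0"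
  then show "A *v x = \<mu> *\<^sub>R x"
    by (intro eqI_B) (auto simp: inner_mult_vec)
qed

lemma eigenspace_eq_span: "{x. A *v x = \<mu> *\<^sub>R x} = span {b \<in> B. ev b = \<mu>}"
proof
  show "{x. A *v x = \<mu> *\<^sub>R x} \<subseteq> span {b \<in> B. ev b = \<mu>}"
  proof
    fix x assume "x \<in> {x. A *v x = \<mu> *\<^sub>R x}"
    then have x: "\<And>b. b \<in> B \<Longrightarrow> ev b \<noteq> \<mu> \<Longrightarrow> x \<bullet> b = 0"
      using eigenvector_iff[of x \<mu>] by blast
    show "x \<in> span {b \<in> B. ev b = \<mu>}"
      by (subst expansion, rule span_sum) (metis (mono_tags, lifting) mem_Collect_eq scaleR_zero_left
          span_base span_scale span_zero x)
  qed
  show "span {b \<in> B. ev b = \<mu>} \<subseteq> {x. A *v x = \<mu> *\<^sub>R x}"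
  proof (rule span_minimal)
    show "{b \<in> B. ev b = \<mu>} \<subseteq> {x. A *v x = \<mu> *\<^sub>R x}"
      using ev by blast
    show "subspace {x. A *v x = \<mu> *\<^sub>R x}"
      by (rule subspaceI)
        (simp_all add: matrix_vector_right_distrib matrix_vector_mult_scaleR scaleR_add_right)
  qed
qed

text \<open>Translates geometric multiplicity into a count of basis vectors, so that nondegeneracy
  becomes a statement about the fibres of \<open>ev\<close>.\<close>

lemma dim_eigenspace: "dim {x. A *v x = \<mu> *\<^sub>R x} = card {b \<in> B. ev b = \<mu>}"
  unfolding eigenspace_eq_span dim_span
  by (rule dim_eq_card_independent, rule independent_mono[OF independent_B]) auto

end

section \<open>Spectral decomposition of symmetric matrices and moments\<close>

lemma symmetric_matrix_eigenbasis_exists: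
  fixes A :: "real^'n^'n"
  assumes "transpose A = A"
  obtains B ev where "orthonormal_eigenbasis A B ev"
proof -
  have "(A *v x) \<bullet> y = x \<bullet> (A *v y)" for x y
    using dot_lmul_matrix[of x A y] transpose_matrix_vector[of A x] by (simp only: assms)
  from self_adjoint_orthonormal_eigenbasis[OF matrix_vector_mul_linear this subspace_UNIV]
  obtain B where B: "pairwise orthogonal B" "\<forall>b\<in>B. norm b = 1 \<and> (\<exists>c. A *v b = c *\<^sub>R b)"
    "span B = UNIV" by auto
  then obtain ev where "\<forall>b\<in>B. A *v b = ev b *\<^sub>R b" by metis
  then show thesis using B that[of B ev] by (auto simp: orthonormal_eigenbasis_def)
qed

text \<open>The spectral decomposition of the powers. Exponent 0 is the completeness relation of the
  basis, and each further factor \<open>\<Lambda>\<close> contributes one eigenvalue.\<close>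

lemma mat_pow_entry:
  assumes "orthonormal_eigenbasis \<Lambda> B ev"
  shows "mat_pow \<Lambda> n $ j $ k = (\<Sum>b\<in>B. ev b ^ n * b $ j * b $ k)"
proof (induction n arbitrary: j)
  interpret orthonormal_eigenbasis \<Lambda> B ev by fact
  case 0
  have "(mat 1 :: real^8^8) $ j $ k = axis k 1 $ j" by (simp add: mat_def axis_def)
  also have "\<dots> = (\<Sum>b\<in>B. (axis k 1 \<bullet> b) *\<^sub>R b) $ j"
    by (subst expansion[of "axis k 1"]) simp
  also have "\<dots> = (\<Sum>b\<in>B. b $ j * b $ k)"
    by (simp add: inner_axis' mult.commute)
  finally show ?case by (simp add: mat_pow_def)
next
  interpret orthonormal_eigenbasis \<Lambda> B ev by fact
  case (Suc n)
  have "mat_pow \<Lambda> (Suc n) $ j $ k = (\<Sum>l\<in>UNIV. \<Lambda> $ j $ l * mat_pow \<Lambda> n $ l $ k)"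
    by (simp add: mat_pow_def matrix_matrix_mult_def)
  also have "\<dots> = (\<Sum>b\<in>B. ev b ^ n * (\<Lambda> *v b) $ j * b $ k)"
    unfolding Suc matrix_vector_mult_def
    by (simp add: sum_distrib_left sum_distrib_right sum.swap[of _ B UNIV] mult_ac)
  also have "\<dots> = (\<Sum>b\<in>B. ev b ^ Suc n * b $ j * b $ k)"
    by (simp add: ev mult_ac)
  finally show ?case .
qed

text \<open>Evaluate the moments on the Lagrange polynomial that vanishes at all values other than \<open>\<mu>\<close>.\<close>

lemma vanishing_moments:
  fixes q ev :: "'a \<Rightarrow> real"
  assumes "finite B" and moments: "\<And>m. m < card B \<Longrightarrow> (\<Sum>b\<in>B. ev b ^ m * q b) = 0"
  shows "(\<Sum>b | b \<in> B \<and> ev b = \<mu>. q b) = 0"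
proof (cases "\<mu> \<in> ev ` B")
  case True
  define p where "p = (\<Prod>\<nu>\<in>ev ` B - {\<mu>}. [:- \<nu>, 1:])"
  \<comment> \<open>There is one linear factor for each distinct value other than
    \<open>\<mu>\<close>, so the degree stays below \<open>card B\<close> and the assumed moments
    suffice.\<close>
  have "degree p \<le> (\<Sum>\<nu>\<in>ev ` B - {\<mu>}. 1)"
    unfolding p_def by (rule order.trans[OF degree_prod_sum_le]) (auto simp: assms)
  also have "\<dots> = card (ev ` B - {\<mu>})" by simp
  also have "\<dots> < card (ev ` B)"
    using True assms(1) by (intro card_Diff1_less) auto
  also have "\<dots> \<le> card B" by (rule card_image_le[OF assms(1)])
  finally have deg: "degree p < card B" .
  have p0: "poly p (ev b) = 0 \<longleftrightarrow> ev b \<noteq> \<mu>" if "b \<in> B" for b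
    using that assms(1) by (auto simp: p_def poly_prod)
  have "(\<Sum>b\<in>B. poly p (ev b) * q b) = (\<Sum>m\<le>degree p. coeff p m * (\<Sum>b\<in>B. ev b ^ m * q b))"
    unfolding poly_altdef sum_distrib_left sum_distrib_right
    by (subst sum.swap) (simp add: mult_ac)
  also have "\<dots> = 0" using deg by (intro sum.neutral) (simp add: moments)
  also have "(\<Sum>b\<in>B. poly p (ev b) * q b) = (\<Sum>b | b \<in> B \<and> ev b = \<mu>. poly p (ev b) * q b)"
    using assms(1) p0 by (intro sum.mono_neutral_right) auto
  also have "\<dots> = poly p \<mu> * (\<Sum>b | b \<in> B \<and> ev b = \<mu>. q b)"
    by (simp add: sum_distrib_left)
  finally show ?thesis using True p0 by auto
next
  case False
  then have "{b \<in> B. ev b = \<mu>} = {}" by auto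
  then show ?thesis by (simp only: sum.empty)
qed

section \<open>Bilinears as Hermitian matrices\<close>

definition adj :: "complex^3^3 \<Rightarrow> complex^3^3" where
  "adj A = transpose (conj_mat A)"

definition herm_of :: "real^8 \<Rightarrow> complex^3^3" where
  "herm_of x = (\<Sum>i\<in>UNIV. x $ i *\<^sub>R su3_gen i)"

text \<open>Inverse of \<open>herm_of\<close> on traceless Hermitian matrices; on other Hermitian
  matrices it drops the trace part. The factor 2 compensates the normalisation of
  \<open>trace_su3_gen_mult\<close>.\<close>

definition coords_of :: "complex^3^3 \<Rightarrow> real^8" where
  "coords_of H = (\<chi> k. 2 * Re (trace (H ** su3_gen k)))"

lemma adj_entry: "adj A $ i $ j = cnj (A $ j $ i)"
  by (simp add: adj_def transpose_def conj_mat_def)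

lemma adj_mult: "adj (A ** B) = adj B ** adj A"
  by (simp add: vec_eq_iff adj_entry matrix_matrix_mult_def mult.commute)

lemma adj_adj [simp]: "adj (adj A) = A"
  by (simp add: vec_eq_iff adj_entry)

lemma adj_diff: "adj (A - B) = adj A - adj B"
  by (simp add: vec_eq_iff adj_entry)

lemma adj_scaleR: "adj (c *\<^sub>R A) = c *\<^sub>R adj A"
  by (simp add: vec_eq_iff adj_entry)

lemma adj_mat_1 [simp]: "adj (mat 1) = mat 1"
  by (simp add: vec_eq_iff adj_entry mat_def)

lemma conj_mat_mult: "conj_mat (A ** B) = conj_mat A ** conj_mat B"
  by (simp add: vec_eq_iff conj_mat_def matrix_matrix_mult_def)

lemma transpose_adj: "transpose (adj A) = conj_mat A"
  by (simp add: adj_def)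

lemma conj_mat_transpose: "conj_mat (transpose A) = adj A"
  by (simp add: adj_def conj_mat_def transpose_def)

lemma unitary_mat_iff: "unitary_mat U \<longleftrightarrow> adj U ** U = mat 1"
  unfolding unitary_mat_def adj_def using matrix_left_right_inverse by blast

lemma unitary_mat_adj:
  assumes "unitary_mat U"
  shows "adj U ** U = mat 1" "U ** adj U = mat 1"
  using assms by (simp_all add: unitary_mat_def adj_def)

lemma unitary_mat_transpose:
  assumes "unitary_mat U"
  shows "transpose U ** conj_mat U = mat 1" "conj_mat U ** transpose U = mat 1"
  using unitary_mat_adj[OF assms, THEN arg_cong[where f = transpose]]
  by (simp_all add: matrix_transpose_mul transpose_adj)

lemma unitary_mat_transpose_unitary: "unitary_mat U \<Longrightarrow> unitary_mat (transpose U)"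
  using unitary_mat_transpose(2)[of U]
  by (simp add: unitary_mat_iff[of "transpose U"] adj_def conj_mat_transpose[unfolded adj_def])

lemma unitary_mat_mult:
  assumes "unitary_mat U" "unitary_mat W"
  shows "unitary_mat (U ** W)"
proof -
  have "adj (U ** W) ** (U ** W) = adj W ** (adj U ** U) ** W"
    by (simp add: adj_mult matrix_mul_assoc)
  then show ?thesis unfolding unitary_mat_iff by (simp add: unitary_mat_adj assms)
qed

lemma matrix_mult_scaleR_right: "A ** (c *\<^sub>R B) = c *\<^sub>R (A ** (B :: complex^3^3))"
  by (simp add: matrix_matrix_mult_def vec_eq_iff scaleR_sum_right)

lemma matrix_mult_sum_right: "A ** (\<Sum>k\<in>S. C k) = (\<Sum>k\<in>S. A ** (C k :: complex^3^3))"
  by (simp add: matrix_matrix_mult_def vec_eq_iff sum_distrib_left sum.swap[of _ S])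

lemma trace_transpose: "trace (transpose A) = trace A"
  by (simp add: trace_def transpose_def)

lemma trace_conjugate:
  fixes A B C :: "'a::comm_semiring_1^'n^'n"
  assumes "A ** C = mat 1"
  shows "trace (C ** B ** A) = trace B"
  by (simp add: trace_mul_sym[of "C ** B"] matrix_mul_assoc assms)

lemma trace_cyclic:
  fixes A B C :: "'a::comm_semiring_1^'n^'n"
  shows "trace (A ** B ** C) = trace (C ** A ** B)"
  by (simp add: trace_mul_sym[of "A ** B"] matrix_mul_assoc)

lemma linear_herm_of: "linear herm_of"
  by (rule linearI) (simp_all add: herm_of_def scaleR_add_left sum.distrib scaleR_sum_right)

lemma adj_herm_of: "adj (herm_of x) = herm_of x"
  by (simp add: herm_of_def vec_eq_iff adj_entry su3_gen_hermitian)

lemma trace_herm_of: "trace (herm_of x) = 0"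
  by (simp add: herm_of_def trace_sum trace_scaleR trace_su3_gen)

lemma trace_mult_herm_of: "trace (H ** herm_of y) = (\<Sum>k\<in>UNIV. y $ k *\<^sub>R trace (H ** su3_gen k))"
  by (simp add: herm_of_def matrix_mult_sum_right matrix_mult_scaleR_right trace_sum trace_scaleR)

lemma inner_coords_of: "coords_of H \<bullet> y = 2 * Re (trace (H ** herm_of y))"
  by (simp add: trace_mult_herm_of coords_of_def inner_vec_def sum_distrib_left mult_ac)

lemma coords_of_herm_of: "coords_of (herm_of x) = x"
proof -
  have "2 * Re (trace (herm_of x ** su3_gen k)) = x $ k" for k
    unfolding trace_mul_sym[of "herm_of x"] trace_mult_herm_of trace_su3_gen_mult
    by (simp add: sum_distrib_left if_distrib[of Re] if_distrib[of "(*) _"] cong: if_cong)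
  then show ?thesis by (simp add: coords_of_def vec_eq_iff)
qed

lemma herm_of_coords_of:
  assumes "adj H = H" and "trace H = 0"
  shows "herm_of (coords_of H) = H"
proof -
  have "cnj (H $ a $ b) = H $ b $ a" for a b
    using assms(1) by (metis adj_entry)
  from hermitian_expansion[OF this] assms(2)
  show ?thesis by (simp add: herm_of_def coords_of_def)
qed

lemma herm_of_eq_iff: "herm_of x = herm_of y \<longleftrightarrow> x = y"
  by (metis coords_of_herm_of)

lemma inner_eq_trace: "x \<bullet> y = 2 * Re (trace (herm_of x ** herm_of y))"
  using inner_coords_of[of "herm_of x" y] by (simp add: coords_of_herm_of)

section \<open>The symmetric product given by the tensor d\<close>

definition d_square :: "real^8 \<Rightarrow> real^8" where
  "d_square x = (\<chi> i. \<Sum>j\<in>UNIV. \<Sum>k\<in>UNIV. d_tensor i j k * x $ j * x $ k)"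

text \<open>The tensor d is a symmetrised trace of three generators. Contracting two slots with the
  same vector makes both orderings equal by cyclicity, which leaves one trace.\<close>

lemma d_tensor_quadratic_form:
  "(\<Sum>j\<in>UNIV. \<Sum>k\<in>UNIV. d_tensor i j k * x $ j * x $ k)
    = 4 * Re (trace (herm_of x ** herm_of x ** su3_gen i))"
proof -
  let ?t = su3_gen and ?X = "herm_of x"
  have "(\<Sum>k\<in>UNIV. d_tensor i j k * x $ j * x $ k)
      = x $ j * (2 * Re (trace ((?t i ** ?t j + ?t j ** ?t i) ** ?X)))" for j
    unfolding trace_mult_herm_of
    by (simp add: d_tensor_trace sum_distrib_left mult_ac)
  also have "\<dots> j = x $ j * (2 * Re (trace ((?X ** ?t i + ?t i ** ?X) ** ?t j)))" for j
  proof -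
    have "trace (?t i ** ?t j ** ?X) = trace (?X ** ?t i ** ?t j)"
      by (rule trace_cyclic)
    moreover have "trace (?t j ** ?t i ** ?X) = trace (?t i ** ?X ** ?t j)"
      by (rule trace_cyclic[symmetric])
    ultimately show ?thesis by (simp add: matrix_mult_add_left trace_add)
  qed
  finally have "(\<Sum>j\<in>UNIV. \<Sum>k\<in>UNIV. d_tensor i j k * x $ j * x $ k)
      = 2 * Re (trace ((?X ** ?t i + ?t i ** ?X) ** ?X))"
    by (simp add: trace_mult_herm_of sum_distrib_left mult_ac)
  also have "trace ((?X ** ?t i + ?t i ** ?X) ** ?X) = 2 * trace (?X ** ?X ** ?t i)"
  proof -
    have "trace (?X ** ?t i ** ?X) = trace (?X ** ?X ** ?t i)"
      by (rule trace_cyclic)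
    moreover have "trace (?t i ** ?X ** ?X) = trace (?X ** ?X ** ?t i)"
      by (rule trace_cyclic[symmetric])
    ultimately show ?thesis by (simp add: matrix_mult_add_left trace_add)
  qed
  finally show ?thesis by simp
qed

lemma d_square_eq: "d_square x = coords_of (2 *\<^sub>R (herm_of x ** herm_of x))"
  by (simp add: d_square_def d_tensor_quadratic_form coords_of_def scaleR_matrix_mult trace_scaleR)

lemma inner_d_square: "d_square x \<bullet> y = 4 * Re (trace (herm_of x ** herm_of x ** herm_of y))"
  by (simp add: d_square_eq inner_coords_of scaleR_matrix_mult trace_scaleR)

text \<open>Splits twice the square of a traceless Hermitian matrix into its scalar part and its
  traceless part; \<open>d_square\<close> is the latter. This turns self-alignment into a quadratic
  matrix equation.\<close>

lemma herm_of_square: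
  "2 *\<^sub>R (herm_of x ** herm_of x) = ((x \<bullet> x) / 3) *\<^sub>R mat 1 + herm_of (d_square x)"
proof -
  let ?H = "2 *\<^sub>R (herm_of x ** herm_of x)"
  have "adj ?H = ?H" by (simp add: adj_scaleR adj_mult adj_herm_of)
  then have "cnj (?H $ a $ b) = ?H $ b $ a" for a b by (metis adj_entry)
  from hermitian_expansion[OF this]
  show ?thesis
    by (simp only: d_square_eq coords_of_def herm_of_def[of "\<chi> k. _ k"] vec_lambda_beta
        trace_scaleR inner_eq_trace) simp
qed

text \<open>For unitary \<open>U\<close> this is the adjoint representation: the effect of a basis
  change of the doublets on the eight-dimensional vectors.\<close>

definition rot :: "complex^3^3 \<Rightarrow> real^8^8" where
  "rot U = matrix (\<lambda>x. coords_of (U ** herm_of x ** adj U))"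

lemma linear_coords_of_sandwich: "linear (\<lambda>x. coords_of (A ** herm_of x ** C))"
  by (rule linearI)
    (simp_all add: coords_of_def vec_eq_iff linear_add[OF linear_herm_of]
      linear_scale[OF linear_herm_of] matrix_add_ldistrib matrix_mult_add_left trace_add
      matrix_mult_scaleR_right scaleR_matrix_mult trace_scaleR distrib_left)

lemma rot_vec: "rot U *v x = coords_of (U ** herm_of x ** adj U)"
  unfolding rot_def by (rule fun_cong[OF matrix_vector_mul(2)[OF linear_coords_of_sandwich]])

lemma herm_of_rot:
  assumes "unitary_mat U"
  shows "herm_of (rot U *v x) = U ** herm_of x ** adj U"
  unfolding rot_vec
  by (rule herm_of_coords_of)
    (simp_all add: adj_mult adj_herm_of matrix_mul_assoc
      trace_conjugate[OF unitary_mat_adj(1)[OF assms]] trace_herm_of)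

lemma unitary_mat_adj_unitary: "unitary_mat U \<Longrightarrow> unitary_mat (adj U)"
  unfolding unitary_mat_iff[of "adj U"] by (simp add: unitary_mat_adj)

lemma rot_adj_rot:
  assumes "unitary_mat U"
  shows "rot (adj U) *v (rot U *v x) = x"
proof -
  have "herm_of (rot (adj U) *v (rot U *v x)) = (adj U ** U) ** herm_of x ** (adj U ** U)"
    by (simp only: herm_of_rot assms unitary_mat_adj_unitary adj_adj matrix_mul_assoc)
  then show ?thesis
    by (simp add: unitary_mat_adj assms herm_of_eq_iff)
qed

lemma rot_rot_adj:
  assumes "unitary_mat U"
  shows "rot U *v (rot (adj U) *v x) = x"
  using rot_adj_rot[OF unitary_mat_adj_unitary[OF assms]] by simp

lemma inner_rot:
  assumes "unitary_mat U"
  shows "(rot U *v x) \<bullet> y = x \<bullet> (rot (adj U) *v y)"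
proof -
  have "trace (U ** herm_of x ** adj U ** herm_of y) = trace (herm_of x ** (adj U ** herm_of y ** U))"
    by (simp add: trace_mul_sym[of U] flip: matrix_mul_assoc)
  then show ?thesis
    by (simp add: inner_eq_trace herm_of_rot assms unitary_mat_adj_unitary)
qed

lemma inner_rot_rot:
  assumes "unitary_mat U"
  shows "(rot U *v x) \<bullet> (rot U *v y) = x \<bullet> y"
  by (simp add: inner_rot rot_adj_rot assms)

text \<open>The cubic trace behind \<open>d_square\<close> is invariant under conjugation, so basis
  changes respect the product.\<close>

lemma inner_d_square_rot:
  assumes U: "unitary_mat U"
  shows "d_square (rot U *v x) \<bullet> (rot U *v y) = d_square x \<bullet> y"
proof -
  have "(U ** herm_of x ** adj U) ** (U ** herm_of x ** adj U) ** (U ** herm_of y ** adj U)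
      = U ** herm_of x ** (adj U ** U) ** herm_of x ** (adj U ** U) ** herm_of y ** adj U"
    by (simp only: matrix_mul_assoc)
  also have "\<dots> = U ** (herm_of x ** herm_of x ** herm_of y) ** adj U"
    by (simp add: unitary_mat_adj U matrix_mul_assoc)
  finally show ?thesis
    by (simp add: inner_d_square herm_of_rot U trace_conjugate unitary_mat_adj)
qed

section \<open>Generalized CP transformations of the bilinears\<close>

text \<open>The adjoint of the action of the CP map on bilinears, see
  \<open>inner_bilinear_cp_map\<close>; it thus acts on coefficient vectors of the potential. On
  Hermitian matrices the transpose is complex conjugation.\<close>

definition cp_rot :: "complex^3^3 \<Rightarrow> real^8 \<Rightarrow> real^8" where
  "cp_rot X x = coords_of (transpose X ** transpose (herm_of x) ** conj_mat X)"

text \<open>The indices are swapped so that the trace of \<open>H ** gram \<phi>\<close> is the form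
  with coefficients \<open>H\<close> in the products \<open>dag_prod\<close>.\<close>

definition gram :: "higgs_fields \<Rightarrow> complex^3^3" where
  "gram \<phi> = (\<chi> a b. dag_prod \<phi> b a)"

lemma gram_cp_map: "gram (cp_map X \<phi>) = X ** transpose (gram \<phi>) ** adj X"
  by (simp add: vec_eq_iff gram_def cp_map_def dag_prod_def matrix_matrix_mult_def transpose_def
      adj_entry sum_2 sum_3 algebra_simps)

lemma inner_bilinear: "x \<bullet> bilinear \<phi> = Re (trace (herm_of x ** gram \<phi>))"
proof -
  have "bilinear \<phi> $ i = Re (trace (su3_gen i ** gram \<phi>))" for i
    by (simp add: bilinear_def trace_def matrix_matrix_mult_def gram_def)
  then show ?thesis
    by (simp add: trace_mul_sym[of "herm_of x"] trace_mult_herm_of inner_vec_def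
        trace_mul_sym[of "gram \<phi>"])
qed

lemma bilinear0_gram: "bilinear0 \<phi> = Re (trace (gram \<phi>)) / sqrt 3"
  by (simp add: bilinear0_def gram_def trace_def)

lemma bilinear0_cp_map: "unitary_mat X \<Longrightarrow> bilinear0 (cp_map X \<phi>) = bilinear0 \<phi>"
  by (simp add: bilinear0_gram gram_cp_map trace_conjugate unitary_mat_adj trace_transpose)

lemma herm_of_cp_rot:
  assumes "unitary_mat X"
  shows "herm_of (cp_rot X x) = transpose X ** transpose (herm_of x) ** conj_mat X"
  unfolding cp_rot_def
proof (rule herm_of_coords_of)
  have "adj (transpose A) = transpose (adj A)" "adj (conj_mat A) = transpose A" for A
    by (simp_all add: vec_eq_iff adj_entry transpose_def conj_mat_def)
  then show "adj (transpose X ** transpose (herm_of x) ** conj_mat X)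
      = transpose X ** transpose (herm_of x) ** conj_mat X"
    using transpose_adj[of "herm_of x"] by (simp add: adj_mult transpose_adj matrix_mul_assoc adj_herm_of)
  show "trace (transpose X ** transpose (herm_of x) ** conj_mat X) = 0"
    by (simp add: trace_conjugate unitary_mat_transpose assms trace_transpose trace_herm_of)
qed

text \<open>Transposing under the trace and rotating the factors cyclically moves the transformation
  from the fields to the coefficients.\<close>

lemma inner_bilinear_cp_map:
  assumes "unitary_mat X"
  shows "x \<bullet> bilinear (cp_map X \<phi>) = cp_rot X x \<bullet> bilinear \<phi>"
proof -
  have "trace (herm_of x ** (X ** transpose (gram \<phi>) ** adj X))
      = trace (transpose (herm_of x ** (X ** transpose (gram \<phi>) ** adj X)))"
    by (simp only: trace_transpose)
  also have "\<dots> = trace (conj_mat X ** gram \<phi> ** transpose X ** transpose (herm_of x))"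
    by (simp add: matrix_transpose_mul transpose_adj matrix_mul_assoc)
  also have "\<dots> = trace (transpose X ** transpose (herm_of x) ** conj_mat X ** gram \<phi>)"
    using trace_cyclic[of "conj_mat X ** gram \<phi>" "transpose X" "transpose (herm_of x)"]
      trace_cyclic[of "transpose (herm_of x)" "conj_mat X ** gram \<phi>" "transpose X"]
    by (simp add: matrix_mul_assoc)
  finally show ?thesis
    by (simp add: inner_bilinear gram_cp_map herm_of_cp_rot assms)
qed

lemma linear_cp_rot: "linear (cp_rot X)"
proof -
  have *: "transpose (A + B) = transpose A + transpose B" "transpose (c *\<^sub>R A) = c *\<^sub>R transpose A"
    for A B :: "complex^3^3" and c :: real
    by (simp_all add: vec_eq_iff transpose_def)
  show ?thesis
    by (rule linearI)
      (simp_all add: cp_rot_def coords_of_def vec_eq_iff linear_add[OF linear_herm_of] *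
        linear_scale[OF linear_herm_of] matrix_add_ldistrib matrix_mult_add_left trace_add
        matrix_mult_scaleR_right scaleR_matrix_mult trace_scaleR distrib_left)
qed

lemma inner_cp_rot:
  assumes "unitary_mat X"
  shows "cp_rot X x \<bullet> cp_rot X y = x \<bullet> y"
proof -
  have "transpose X ** transpose (herm_of x) ** conj_mat X ** (transpose X ** transpose (herm_of y) ** conj_mat X)
     = transpose X ** transpose (herm_of x) ** (conj_mat X ** transpose X) ** transpose (herm_of y) ** conj_mat X"
    by (simp only: matrix_mul_assoc)
  also have "\<dots> = transpose X ** transpose (herm_of y ** herm_of x) ** conj_mat X"
    by (simp add: unitary_mat_transpose assms matrix_transpose_mul matrix_mul_assoc)
  finally show ?thesis
    by (simp add: inner_eq_trace herm_of_cp_rot assms trace_conjugate unitary_mat_transpose trace_transpose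
        trace_mul_sym[of "herm_of y"])
qed

section \<open>Self-aligned vectors\<close>

definition outer :: "complex^3 \<Rightarrow> complex^3^3" where
  "outer e = (\<chi> i j. e $ i * cnj (e $ j))"

definition unit_vec :: "complex^3 \<Rightarrow> bool" where
  "unit_vec e \<longleftrightarrow> (\<Sum>i\<in>UNIV. cnj (e $ i) * e $ i) = 1"

section \<open>Orthogonal projectors and their rank\<close>

definition projector :: "complex^3^3 \<Rightarrow> bool" where
  "projector P \<longleftrightarrow> adj P = P \<and> P ** P = P"

lemma matrix_mult_diff_left: "(A - C) ** B = A ** B - C ** (B :: complex^3^3)"
  by (simp add: matrix_matrix_mult_def vec_eq_iff left_diff_distrib sum_subtractf)

lemma matrix_mult_diff_right: "B ** (A - C) = B ** A - B ** (C :: complex^3^3)"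
  by (simp add: matrix_matrix_mult_def vec_eq_iff right_diff_distrib sum_subtractf)

lemma adj_outer: "adj (outer e) = outer e"
  by (simp add: vec_eq_iff adj_entry outer_def mult.commute)

lemma trace_outer: "unit_vec e \<Longrightarrow> trace (outer e) = 1"
  by (simp add: trace_def outer_def unit_vec_def mult.commute)

lemma mult_outer: "A ** outer e = (\<chi> i j. (A *v e) $ i * cnj (e $ j))"
  by (simp add: matrix_matrix_mult_def outer_def vec_eq_iff matrix_vector_mult_def
      sum_distrib_right mult.assoc)

lemma conjugate_outer: "U ** outer e ** adj U = outer (U *v e)"
proof -
  have "(U ** outer e) ** adj U = (\<chi> i j. \<Sum>k\<in>UNIV. (U *v e) $ i * cnj (e $ k) * cnj (U $ j $ k))"
    unfolding mult_outer by (simp add: matrix_matrix_mult_def adj_entry)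
  also have "\<dots> = outer (U *v e)"
    by (simp add: outer_def vec_eq_iff matrix_vector_mult_def sum_distrib_left mult_ac)
  finally show ?thesis .
qed

lemma outer_idem:
  assumes "unit_vec e"
  shows "outer e ** outer e = outer e"
proof -
  have *: "outer e *v e = e"
    using assms by (simp add: vec_eq_iff outer_def matrix_vector_mult_def unit_vec_def mult.assoc
        flip: sum_distrib_left)
  show ?thesis unfolding mult_outer * by (simp add: outer_def)
qed

text \<open>Since \<open>P = P ** adj P\<close>, the trace is a sum of squared moduli: real,
  nonnegative, and zero only for \<open>P = 0\<close>. It serves as a substitute for the
  rank.\<close>

lemma trace_projector: "projector P \<Longrightarrow> trace P = of_real (\<Sum>i\<in>UNIV. \<Sum>j\<in>UNIV. (cmod (P $ i $ j))\<^sup>2)"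
proof -
  assume "projector P"
  then have "trace P = trace (P ** adj P)" by (simp add: projector_def)
  then show ?thesis
    by (simp add: trace_def matrix_matrix_mult_def adj_entry complex_norm_square del: of_real_power)
qed

lemma projector_eq_0:
  assumes "projector P" "trace P = 0"
  shows "P = 0"
proof -
  have "(\<Sum>i\<in>UNIV. \<Sum>j\<in>UNIV. (cmod (P $ i $ j))\<^sup>2) = 0"
    using assms trace_projector[OF assms(1)] by (metis of_real_eq_0_iff)
  then show ?thesis
    by (simp add: sum_nonneg_eq_0_iff sum_nonneg vec_eq_iff)
qed

text \<open>Idempotence says that every column of \<open>P\<close> is fixed by \<open>P\<close>. A
  nonzero column, normalised, is the required \<open>e\<close>.\<close>

lemma projector_split:
  assumes P: "projector P" and "P \<noteq> 0"
  obtains e where "unit_vec e" "projector (P - outer e)"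
proof -
  obtain a b where ab: "P $ a $ b \<noteq> 0"
    using \<open>P \<noteq> 0\<close> by (auto simp: vec_eq_iff)
  define s where "s = (\<Sum>i\<in>UNIV. (cmod (P $ i $ b))\<^sup>2)"
  define e where "e = (\<chi> i. P $ i $ b / of_real (sqrt s))"
  have "s > 0"
    unfolding s_def using ab by (intro sum_pos2[of _ a]) auto
  have idem: "(\<Sum>j\<in>UNIV. P $ i $ j * P $ j $ k) = P $ i $ k" for i k
    using P by (simp add: projector_def matrix_matrix_mult_def vec_eq_iff)
  have "(\<Sum>i\<in>UNIV. cnj (e $ i) * e $ i) = of_real s / (of_real (sqrt s) * of_real (sqrt s))"
    by (simp add: e_def s_def complex_norm_square sum_divide_distrib mult.commute
        del: of_real_power)
  also have "\<dots> = 1"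
    using \<open>s > 0\<close> by (simp flip: of_real_mult)
  finally have e: "unit_vec e" by (simp add: unit_vec_def)
  have *: "P *v e = e"
    by (simp add: vec_eq_iff e_def matrix_vector_mult_def idem flip: sum_divide_distrib)
  have PO: "P ** outer e = outer e" unfolding mult_outer * by (simp add: outer_def)
  then have OP: "outer e ** P = outer e"
    using P by (metis adj_mult adj_outer projector_def)
  have "projector (P - outer e)"
    using P by (simp add: projector_def adj_diff adj_outer matrix_mult_diff_left
        matrix_mult_diff_right PO OP outer_idem e)
  with e show thesis by (rule that)
qed

lemma projector_trace_ge_1:
  assumes "projector P" "P \<noteq> 0"
  shows "Re (trace P) \<ge> 1" and "Re (trace P) = 1 \<Longrightarrow> \<exists>e. unit_vec e \<and> P = outer e"
proof -
  obtain e where e: "unit_vec e" "projector (P - outer e)"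
    using projector_split[OF assms] .
  have tr: "trace (P - outer e) = trace P - 1"
    by (simp add: trace_sub trace_outer e)
  have t: "trace (P - outer e) = of_real (\<Sum>i\<in>UNIV. \<Sum>j\<in>UNIV. (cmod ((P - outer e) $ i $ j))\<^sup>2)"
    by (rule trace_projector[OF e(2)])
  then have "Re (trace (P - outer e)) \<ge> 0"
    by (simp add: sum_nonneg)
  then show "Re (trace P) \<ge> 1" by (simp add: tr)
  assume "Re (trace P) = 1"
  then have "trace (P - outer e) = 0"
    using t tr by (simp add: complex_eq_iff)
  then have "P = outer e"
    using projector_eq_0[OF e(2)] by simp
  with e show "\<exists>e. unit_vec e \<and> P = outer e" by blast
qed

lemma trace_mat_1: "trace (mat 1 :: complex^3^3) = 3"
  by (simp add: trace_def mat_def)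

text \<open>Peel off a rank-one part. If something remains, \<open>P\<close> has trace at least 2;
  the nonzero complement has trace at least 1, and the two traces add up to 3, so the complement has
  rank one.\<close>

lemma projector_rank_one_or_two:
  assumes P: "projector P" "P \<noteq> 0" "P \<noteq> mat 1"
  shows "\<exists>e. unit_vec e \<and> (P = outer e \<or> mat 1 - P = outer e)"
proof -
  obtain e where e: "unit_vec e" "projector (P - outer e)"
    using projector_split[OF P(1,2)] .
  show ?thesis
  proof (cases "P - outer e = 0")
    case True
    with e show ?thesis by auto
  next
    case False
    have C: "projector (mat 1 - P)" "mat 1 - P \<noteq> 0"
      using P by (auto simp: projector_def adj_diff matrix_mult_diff_left matrix_mult_diff_right)
    have "Re (trace P) \<ge> 2"
      using projector_trace_ge_1(1)[OF e(2) False] e by (simp add: trace_sub trace_outer)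
    then have "Re (trace (mat 1 - P)) = 1"
      using projector_trace_ge_1(1)[OF C] by (simp add: trace_sub trace_mat_1)
    then show ?thesis using projector_trace_ge_1(2)[OF C] by blast
  qed
qed

text \<open>Self-alignment makes \<open>herm_of v\<close> a root of a quadratic polynomial, and a traceless Hermitian
  matrix with two eigenvalues has a simple and a double one.\<close>

lemma self_aligned_herm_of:
  assumes "v \<noteq> 0" and ds: "d_square v = \<beta> *\<^sub>R v"
  obtains e \<kappa> where "unit_vec e" "herm_of v = \<kappa> *\<^sub>R (mat 1 - 3 *\<^sub>R outer e)"
proof -
  define N where "N = herm_of v"
  \<comment> \<open>By \<open>herm_of_square\<close>, \<open>N\<close> is a root of
    \<open>x^2 - (\<beta>/2) x - \<alpha>\<close>. The roots of this polynomial are \<open>r\<close>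
    and \<open>r + D\<close>, and \<open>P\<close> is the spectral projector of \<open>N\<close> for
    \<open>r + D\<close>.\<close>
  define \<alpha> where "\<alpha> = (v \<bullet> v) / 6"
  define D where "D = sqrt (\<beta>\<^sup>2 / 4 + 4 * \<alpha>)"
  define r where "r = (\<beta> / 2 - D) / 2"
  define P where "P = (1 / D) *\<^sub>R (N - r *\<^sub>R mat 1)"
  have "\<alpha> > 0" using \<open>v \<noteq> 0\<close> by (simp add: \<alpha>_def)
  then have "\<beta>\<^sup>2 / 4 + 4 * \<alpha> > 0" by (simp add: add_nonneg_pos)
  then have D: "D > 0" "D\<^sup>2 = \<beta>\<^sup>2 / 4 + 4 * \<alpha>" by (simp_all add: D_def)
  have r: "\<alpha> + r\<^sup>2 = - r * D" "\<beta> / 2 - 2 * r = D"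
    using D(2) by (simp_all add: r_def power2_eq_square field_simps)
  have "r * (r + D) = - \<alpha>"
    using r(1) by (simp add: power2_eq_square algebra_simps)
  then have "r \<noteq> 0" "r + D \<noteq> 0"
    using \<open>\<alpha> > 0\<close> by auto
  have NN: "N ** N = \<alpha> *\<^sub>R mat 1 + (\<beta> / 2) *\<^sub>R N"
  proof -
    have "2 *\<^sub>R (N ** N) = (2 * \<alpha>) *\<^sub>R mat 1 + \<beta> *\<^sub>R N"
      using herm_of_square[of v] unfolding ds N_def \<alpha>_def linear_scale[OF linear_herm_of] by simp
    then have "(1 / 2) *\<^sub>R (2 *\<^sub>R (N ** N)) = (1 / 2) *\<^sub>R ((2 * \<alpha>) *\<^sub>R mat 1 + \<beta> *\<^sub>R N)" by simp
    then show ?thesis by (simp add: scaleR_add_right)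
  qed
  have N: "N = r *\<^sub>R mat 1 + D *\<^sub>R P" using D by (simp add: P_def)
  have "(N - r *\<^sub>R mat 1) ** (N - r *\<^sub>R mat 1) = (\<alpha> + r\<^sup>2) *\<^sub>R mat 1 + (\<beta> / 2 - 2 * r) *\<^sub>R N"
    by (simp add: matrix_mult_diff_left matrix_mult_diff_right scaleR_matrix_mult
        matrix_mult_scaleR_right NN scaleR_add_left scaleR_diff_left scaleR_diff_right
        power2_eq_square) (simp add: vec_eq_iff scaleR_conv_of_real)
  also have "\<dots> = D *\<^sub>R (N - r *\<^sub>R mat 1)"
    unfolding r by (simp add: scaleR_diff_right)
  finally have "P ** P = P"
    using D by (simp add: P_def scaleR_matrix_mult matrix_mult_scaleR_right)
  moreover have "adj P = P"
    by (simp add: P_def adj_scaleR adj_diff N_def adj_herm_of)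
  ultimately have P: "projector P" by (simp add: projector_def)
  have trN: "trace N = 0" by (simp add: N_def trace_herm_of)
  have trP: "of_real (3 * r) + of_real D * trace P = 0"
    using trN by (subst (asm) N) (simp add: trace_add trace_scaleR trace_mat_1 mult.commute
        scaleR_conv_of_real[where 'a = complex])
  \<comment> \<open>The product of the two roots is \<open>-\<alpha>\<close>, so neither is zero. A
    traceless \<open>N\<close> therefore cannot be the scalar matrix \<open>r\<close> or
    \<open>r + D\<close>.\<close>
  have P0: "P \<noteq> 0"
    using trP \<open>r \<noteq> 0\<close> by (auto simp: trace_def)
  have P1: "P \<noteq> mat 1"
  proof
    assume "P = mat 1"
    then have "complex_of_real (3 * (r + D)) = 0"
      using trP by (simp add: trace_mat_1 mult.commute)
    then show False using \<open>r + D \<noteq> 0\<close> by (simp only: of_real_eq_0_iff) simp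
  qed
  obtain e where e: "unit_vec e" "P = outer e \<or> mat 1 - P = outer e"
    using projector_rank_one_or_two[OF P P0 P1] by blast
  \<comment> \<open>Vanishing trace fixes the ratio of \<open>r\<close> and \<open>D\<close>: the
    simple eigenvalue is minus twice the double one.\<close>
  from e(2) show thesis
  proof
    assume "P = outer e"
    then have "complex_of_real (3 * r + D) = 0"
      using trP by (simp add: trace_outer e)
    then have "D = - 3 * r" by (simp only: of_real_eq_0_iff)
    then have "herm_of v = r *\<^sub>R (mat 1 - 3 *\<^sub>R outer e)"
      using N \<open>P = outer e\<close> by (simp add: N_def scaleR_diff_right)
    with e(1) show thesis by (rule that)
  next
    assume O: "mat 1 - P = outer e"
    then have P': "P = mat 1 - outer e" by (simp add: algebra_simps)
    then have "complex_of_real (3 * r + 2 * D) = 0"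
      using trP by (simp add: trace_outer e trace_sub trace_mat_1 mult.commute)
    then have "r = - 2 / 3 * D" by (simp only: of_real_eq_0_iff)
    then have rD: "r + D = D / 3" by simp
    have "herm_of v = (r + D) *\<^sub>R mat 1 - D *\<^sub>R outer e"
      using N unfolding P' N_def by (simp add: scaleR_diff_right scaleR_add_left)
    then have "herm_of v = (D / 3) *\<^sub>R (mat 1 - 3 *\<^sub>R outer e)"
      unfolding rD by (simp add: scaleR_diff_right)
    with e(1) show thesis by (rule that)
  qed
qed

lemma unitary_completion:
  assumes "unit_vec e"
  obtains U where "unitary_mat U" "U *v axis 3 1 = e"
proof -
  have e: "cnj (e $ 1) * e $ 1 + cnj (e $ 2) * e $ 2 + cnj (e $ 3) * e $ 3 = 1"
    using assms by (simp add: unit_vec_def sum_3)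
  have "\<exists>U. unitary_mat U \<and> U *v axis 3 1 = e"
  proof (cases "e $ 1 = 0 \<and> e $ 2 = 0")
    case True
    let ?U = "vector [vector [1, 0, 0], vector [0, 1, 0], vector [0, 0, e $ 3]] :: complex^3^3"
    have "unitary_mat ?U"
      using e True by (simp add: unitary_mat_iff vec_eq_iff forall_3 matrix_matrix_mult_def sum_3
          adj_entry mat_def)
    moreover have "?U *v axis 3 1 = e"
      using True by (simp add: vec_eq_iff forall_3 matrix_vector_mult_def sum_3 axis_def)
    ultimately show ?thesis by blast
  next
    case False
    define t where "t = sqrt ((cmod (e $ 1))\<^sup>2 + (cmod (e $ 2))\<^sup>2)"
    define s k where "s = complex_of_real t" and "k = complex_of_real (1 / t)"
    have "(cmod (e $ 1))\<^sup>2 + (cmod (e $ 2))\<^sup>2 > 0"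
      using False by (auto simp: add_pos_nonneg add_nonneg_pos)
    then have t: "t > 0" "t * t = (cmod (e $ 1))\<^sup>2 + (cmod (e $ 2))\<^sup>2"
      by (simp_all add: t_def)
    have sk: "s * k = 1" "cnj s = s" "cnj k = k"
      using t by (simp_all add: s_def k_def)
    have ss: "s * s = e $ 1 * cnj (e $ 1) + e $ 2 * cnj (e $ 2)"
      unfolding s_def of_real_mult[symmetric] t(2) by (simp add: complex_norm_square del: of_real_power)
    \<comment> \<open>The third column is \<open>e\<close>. The second is the normalised component
      of the third axis orthogonal to \<open>e\<close>, and the first is orthogonal to both.
      \<open>s\<close> and \<open>k\<close> stand for \<open>t\<close> and its inverse, which keeps
      the identities polynomial.\<close>
    let ?U = "vector [vector [- cnj (e $ 2) * k, - cnj (e $ 3) * e $ 1 * k, e $ 1],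
      vector [cnj (e $ 1) * k, - cnj (e $ 3) * e $ 2 * k, e $ 2],
      vector [0, s, e $ 3]] :: complex^3^3"
    have "unitary_mat ?U"
      using e sk(1) ss
      by (simp add: unitary_mat_iff vec_eq_iff forall_3 matrix_matrix_mult_def sum_3
          adj_entry mat_def sk(2,3)) (intro conjI; algebra)
    moreover have "?U *v axis 3 1 = e"
      by (simp add: vec_eq_iff forall_3 matrix_vector_mult_def sum_3 axis_def)
    ultimately show ?thesis by blast
  qed
  then show thesis using that by blast
qed

lemma herm_of_axis_8: "herm_of (axis 8 1) = (1 / (2 * sqrt 3)) *\<^sub>R (mat 1 - 3 *\<^sub>R outer (axis 3 1))"
  by (simp add: herm_of_def sum_8 axis_def su3_gen_def gell_mann_simps vec_eq_iff forall_3 outer_def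
      mat_def scaleR_conv_of_real[where 'a = complex])

text \<open>By \<open>herm_of_axis_8\<close> the eighth axis has the normal form of
  \<open>self_aligned_herm_of\<close> with the third basis vector as \<open>e\<close>. Conjugation
  by a unitary with third column \<open>e\<close> matches the two.\<close>

lemma self_aligned_rot:
  assumes "v \<noteq> 0" and "d_square v = \<beta> *\<^sub>R v"
  obtains U c where "unitary_mat U" "v = c *\<^sub>R (rot U *v axis 8 1)"
proof -
  obtain e \<kappa> where e: "unit_vec e" "herm_of v = \<kappa> *\<^sub>R (mat 1 - 3 *\<^sub>R outer e)"
    using self_aligned_herm_of[OF assms] .
  obtain U where U: "unitary_mat U" "U *v axis 3 1 = e"
    using unitary_completion[OF e(1)] .
  have "U ** (mat 1 - 3 *\<^sub>R outer (axis 3 1)) ** adj U = mat 1 - 3 *\<^sub>R outer e"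
    by (simp add: matrix_mult_diff_left matrix_mult_diff_right scaleR_matrix_mult
        matrix_mult_scaleR_right conjugate_outer U unitary_mat_adj)
  then have "herm_of ((\<kappa> * (2 * sqrt 3)) *\<^sub>R (rot U *v axis 8 1)) = herm_of v"
    by (simp add: linear_scale[OF linear_herm_of] herm_of_rot U herm_of_axis_8
        scaleR_matrix_mult matrix_mult_scaleR_right e)
  then have "v = (\<kappa> * (2 * sqrt 3)) *\<^sub>R (rot U *v axis 8 1)"
    by (simp only: herm_of_eq_iff)
  with U(1) show thesis by (rule that)
qed

section \<open>The eigenspaces in the aligned basis\<close>

text \<open>The normal form of a CP4 matrix, except that the phase is left free.\<close>

definition exchange :: "complex \<Rightarrow> complex^3^3" where
  "exchange \<zeta> = vector [vector [0, \<zeta>, 0], vector [- \<zeta>, 0, 0], vector [0, 0, 1]]"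

lemma unitary_exchange:
  assumes "cmod \<zeta> = 1"
  shows "unitary_mat (exchange \<zeta>)"
proof -
  have "\<zeta> * cnj \<zeta> = 1" "cnj \<zeta> * \<zeta> = 1"
    using assms complex_norm_square[of \<zeta>] by (simp_all add: mult.commute)
  then show ?thesis
    by (simp add: unitary_mat_iff exchange_def vec_eq_iff forall_3 matrix_matrix_mult_def sum_3
        adj_entry mat_def)
qed

section \<open>The exchange and \<open>d_square\<close> in coordinates\<close>

lemma herm_of_entries:
  "herm_of x $ 1 $ 1 = of_real (x $ 3 + x $ 8 / sqrt 3) / 2"
  "herm_of x $ 2 $ 2 = of_real (- x $ 3 + x $ 8 / sqrt 3) / 2"
  "herm_of x $ 3 $ 3 = of_real (- 2 * x $ 8 / sqrt 3) / 2"
  "herm_of x $ 1 $ 2 = Complex (x $ 1) (- x $ 2) / 2"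
  "herm_of x $ 2 $ 1 = Complex (x $ 1) (x $ 2) / 2"
  "herm_of x $ 1 $ 3 = Complex (x $ 4) (- x $ 5) / 2"
  "herm_of x $ 3 $ 1 = Complex (x $ 4) (x $ 5) / 2"
  "herm_of x $ 2 $ 3 = Complex (x $ 6) (- x $ 7) / 2"
  "herm_of x $ 3 $ 2 = Complex (x $ 6) (x $ 7) / 2"
  by (simp_all add: herm_of_def sum_8 su3_gen_def gell_mann_simps complex_eq_iff)

lemma vector_8:
  "(vector [a, b, c, d, e, f, g, h] :: 'a::zero^8) $ 1 = a"
  "(vector [a, b, c, d, e, f, g, h] :: 'a::zero^8) $ 2 = b"
  "(vector [a, b, c, d, e, f, g, h] :: 'a::zero^8) $ 3 = c"
  "(vector [a, b, c, d, e, f, g, h] :: 'a::zero^8) $ 4 = d"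
  "(vector [a, b, c, d, e, f, g, h] :: 'a::zero^8) $ 5 = e"
  "(vector [a, b, c, d, e, f, g, h] :: 'a::zero^8) $ 6 = f"
  "(vector [a, b, c, d, e, f, g, h] :: 'a::zero^8) $ 7 = g"
  "(vector [a, b, c, d, e, f, g, h] :: 'a::zero^8) $ 8 = h"
  unfolding vector_def by simp_all

text \<open>The map is -1 on axes 1 to 3 and +1 on axis 8. On axes 4 to 7 it is an isometry with
  square -1, and only this block depends on the phase.\<close>

lemma cp_rot_exchange:
  assumes "cmod (Complex c s) = 1"
  shows "cp_rot (exchange (Complex c s)) x = vector [- x $ 1, - x $ 2, - x $ 3,
    s * x $ 7 - c * x $ 6, s * x $ 6 + c * x $ 7, c * x $ 4 - s * x $ 5,
    - s * x $ 4 - c * x $ 5, x $ 8]" (is "_ = ?y")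
proof -
  have cs: "c * c + s * s = 1"
    using assms by (simp add: cmod_def power2_eq_square)
  \<comment> \<open>Writing the eighth coordinate as a multiple of \<open>sqrt 3\<close> removes the
    root from the matrix entries.\<close>
  obtain q where q: "x $ 8 = sqrt 3 * q"
    using that[of "x $ 8 / sqrt 3"] by simp
  have "herm_of (cp_rot (exchange (Complex c s)) x) = herm_of ?y"
    unfolding herm_of_cp_rot[OF unitary_exchange[OF assms]] vec_eq_iff forall_3
    by (simp add: herm_of_entries vector_8 exchange_def matrix_matrix_mult_def sum_3 transpose_def
        conj_mat_def complex_eq_iff q)
      (use cs in \<open>intro conjI; (algebra | simp add: field_simps)\<close>)
  then show ?thesis by (simp only: herm_of_eq_iff)
qed

text \<open>Read axes 4 to 7 as a point \<open>(z, w)\<close> of C^2 with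
  \<open>z = x4 - i x5\<close> and \<open>w = x6 - i x7\<close>. The components are then the real
  part and minus the imaginary part of \<open>z * cnj w\<close>, and half of
  \<open>|z|^2 - |w|^2\<close>.\<close>

lemma d_square_components:
  assumes "x $ 8 = 0"
  shows "d_square x $ 1 = x $ 4 * x $ 6 + x $ 5 * x $ 7"
    and "d_square x $ 2 = x $ 5 * x $ 6 - x $ 4 * x $ 7"
    and "d_square x $ 3 = ((x $ 4)\<^sup>2 + (x $ 5)\<^sup>2 - (x $ 6)\<^sup>2 - (x $ 7)\<^sup>2) / 2"
  unfolding d_square_def vec_lambda_beta d_tensor_quadratic_form
  by (simp_all add: trace_def matrix_matrix_mult_def sum_3
      herm_of_entries su3_gen_def gell_mann_simps assms algebra_simps power2_eq_square add_divide_distrib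
      diff_divide_distrib)

text \<open>The last two hypotheses say that the matrix with columns \<open>z\<close> and \<open>w\<close> has orthogonal rows of
  equal length. Its columns are unit vectors, so it is unitary, and \<open>z\<close> determines \<open>w\<close> up to a phase.\<close>

lemma unitary_2x2_phase:
  fixes z1 z2 w1 w2 :: complex
  assumes z: "z1 * cnj z1 + z2 * cnj z2 = 1" and w: "w1 * cnj w1 + w2 * cnj w2 = 1"
    and off: "z1 * cnj z2 + w1 * cnj w2 = 0"
    and diag: "z1 * cnj z1 + w1 * cnj w1 = z2 * cnj z2 + w2 * cnj w2"
  obtains \<zeta> where "cmod \<zeta> = 1" "w1 = - \<zeta> * cnj z2" "w2 = \<zeta> * cnj z1"
proof -
  \<comment> \<open>\<open>h\<close> is the Hermitian product of the two columns; row orthonormality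
    gives \<open>w1 * h = w2 * h = 0\<close>, and \<open>w\<close> is nonzero.\<close>
  define h where "h = z1 * cnj w1 + z2 * cnj w2"
  have off': "cnj z1 * z2 + cnj w1 * w2 = 0"
    using arg_cong[OF off, of cnj] by simp
  have r1: "z1 * cnj z1 + w1 * cnj w1 = 1" and r2: "z2 * cnj z2 + w2 * cnj w2 = 1"
    using z w diag by algebra+
  have "w1 * h = 0" "w2 * h = 0"
    using z r1 r2 off off' unfolding h_def by algebra+
  then have "h = 0" using w by auto
  then have "cnj h = 0" by simp
  then have h': "cnj z1 * w1 + cnj z2 * w2 = 0" by (simp add: h_def)
  \<comment> \<open>The phase is the determinant of the unitary matrix.\<close>
  define \<zeta> where "\<zeta> = w2 * z1 - w1 * z2"
  have *: "w1 = - \<zeta> * cnj z2" "w2 = \<zeta> * cnj z1"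
    using z h' unfolding \<zeta>_def by algebra+
  then have **: "cnj w1 = - cnj \<zeta> * z2" "cnj w2 = cnj \<zeta> * z1" by simp_all
  have "\<zeta> * cnj \<zeta> = 1"
    using w z * ** by algebra
  then have "(cmod \<zeta>)\<^sup>2 = 1"
    unfolding complex_norm_square[symmetric] by (simp only: of_real_eq_1_iff)
  then have "cmod \<zeta> = 1" by (simp add: power2_eq_1_iff) (smt (verit) norm_ge_zero)
  from this * show thesis by (rule that)
qed

lemma inner_8: "(x :: real^8) \<bullet> y = x $ 1 * y $ 1 + x $ 2 * y $ 2 + x $ 3 * y $ 3 + x $ 4 * y $ 4 + x $ 5 * y $ 5
    + x $ 6 * y $ 6 + x $ 7 * y $ 7 + x $ 8 * y $ 8"
  by (simp add: inner_vec_def sum_8)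

lemma vec_eq_8: "x = y \<longleftrightarrow> x $ 1 = y $ 1 \<and> x $ 2 = y $ 2 \<and> x $ 3 = y $ 3 \<and> x $ 4 = y $ 4 \<and> x $ 5 = y $ 5
    \<and> x $ 6 = y $ 6 \<and> x $ 7 = y $ 7 \<and> x $ 8 = y $ (8 :: 8)"
  by (simp add: vec_eq_iff forall_8)

text \<open>Two complex numbers of equal modulus with product \<open>z * cnj w = 0\<close> both
  vanish. For a nondegenerate eigenvector the eigenspace sum has a single term, so this removes its
  components on axes 4 to 7.\<close>

lemma d_square_zero_components:
  assumes "x $ 8 = 0" and "\<And>i. i \<in> {1, 2, 3} \<Longrightarrow> d_square x $ i = 0"
  shows "x $ 4 = 0" "x $ 5 = 0" "x $ 6 = 0" "x $ 7 = 0"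
proof -
  define z w where "z = Complex (x $ 4) (- x $ 5)" and "w = Complex (x $ 6) (- x $ 7)"
  have q: "x $ 4 * x $ 6 + x $ 5 * x $ 7 = 0" "x $ 5 * x $ 6 - x $ 4 * x $ 7 = 0"
    "(x $ 4)\<^sup>2 + (x $ 5)\<^sup>2 = (x $ 6)\<^sup>2 + (x $ 7)\<^sup>2"
    using assms(2)[of 1] assms(2)[of 2] assms(2)[of 3] by (simp_all add: d_square_components assms(1))
  have "z * cnj w = 0"
    using q by (simp add: z_def w_def complex_eq_iff algebra_simps)
  moreover have "cmod z = cmod w"
    using q(3) by (simp add: z_def w_def cmod_def)
  ultimately have "z = 0" "w = 0" by auto
  then show "x $ 4 = 0" "x $ 5 = 0" "x $ 6 = 0" "x $ 7 = 0"
    by (simp_all add: z_def w_def complex_eq_iff)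
qed

text \<open>As points of C^2, the two unit vectors satisfy the hypotheses of
  \<open>unitary_2x2_phase\<close>. Its phase is the one that makes the exchange send
  \<open>y\<close> to \<open>y'\<close>, and the square -1 on axes 4 to 7 then sends
  \<open>y'\<close> to \<open>-y\<close>.\<close>

lemma exchange_maps_pair:
  assumes y: "y $ 1 = 0" "y $ 2 = 0" "y $ 3 = 0" "y $ 8 = 0" "norm y = 1"
    and y': "y' $ 1 = 0" "y' $ 2 = 0" "y' $ 3 = 0" "y' $ 8 = 0" "norm y' = 1"
    and d: "\<And>i. i \<in> {1, 2, 3} \<Longrightarrow> d_square y $ i + d_square y' $ i = 0"
  obtains \<zeta> where "cmod \<zeta> = 1" "cp_rot (exchange \<zeta>) y = y'" "cp_rot (exchange \<zeta>) y' = - y"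
proof -
  have n: "(y $ 4)\<^sup>2 + (y $ 5)\<^sup>2 + (y $ 6)\<^sup>2 + (y $ 7)\<^sup>2 = 1"
    "(y' $ 4)\<^sup>2 + (y' $ 5)\<^sup>2 + (y' $ 6)\<^sup>2 + (y' $ 7)\<^sup>2 = 1"
    using y y' by (simp_all add: norm_eq_1 inner_8 power2_eq_square)
  have q: "y $ 4 * y $ 6 + y $ 5 * y $ 7 + (y' $ 4 * y' $ 6 + y' $ 5 * y' $ 7) = 0"
    "y $ 5 * y $ 6 - y $ 4 * y $ 7 + (y' $ 5 * y' $ 6 - y' $ 4 * y' $ 7) = 0"
    "(y $ 4)\<^sup>2 + (y $ 5)\<^sup>2 + (y' $ 4)\<^sup>2 + (y' $ 5)\<^sup>2 = (y $ 6)\<^sup>2 + (y $ 7)\<^sup>2 + (y' $ 6)\<^sup>2 + (y' $ 7)\<^sup>2"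
    using d[of 1] d[of 2] d[of 3] y y' by (simp_all add: d_square_components field_simps)
  obtain \<zeta> where \<zeta>: "cmod \<zeta> = 1"
    "Complex (y' $ 4) (- y' $ 5) = - \<zeta> * cnj (Complex (y $ 6) (- y $ 7))"
    "Complex (y' $ 6) (- y' $ 7) = \<zeta> * cnj (Complex (y $ 4) (- y $ 5))"
  proof (rule unitary_2x2_phase)
    show "Complex (y $ 4) (- y $ 5) * cnj (Complex (y $ 4) (- y $ 5))
        + Complex (y $ 6) (- y $ 7) * cnj (Complex (y $ 6) (- y $ 7)) = 1"
      using n by (simp add: complex_eq_iff power2_eq_square)
    show "Complex (y' $ 4) (- y' $ 5) * cnj (Complex (y' $ 4) (- y' $ 5))
        + Complex (y' $ 6) (- y' $ 7) * cnj (Complex (y' $ 6) (- y' $ 7)) = 1"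
      using n by (simp add: complex_eq_iff power2_eq_square)
    show "Complex (y $ 4) (- y $ 5) * cnj (Complex (y $ 6) (- y $ 7))
        + Complex (y' $ 4) (- y' $ 5) * cnj (Complex (y' $ 6) (- y' $ 7)) = 0"
      using q by (simp add: complex_eq_iff algebra_simps)
    show "Complex (y $ 4) (- y $ 5) * cnj (Complex (y $ 4) (- y $ 5))
        + Complex (y' $ 4) (- y' $ 5) * cnj (Complex (y' $ 4) (- y' $ 5))
        = Complex (y $ 6) (- y $ 7) * cnj (Complex (y $ 6) (- y $ 7))
        + Complex (y' $ 6) (- y' $ 7) * cnj (Complex (y' $ 6) (- y' $ 7))"
      using q by (simp add: complex_eq_iff power2_eq_square)
  qed
  obtain c s where cs: "\<zeta> = Complex c s" by (cases \<zeta>)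
  have one: "c * c + s * s = 1"
    using \<zeta>(1) by (simp add: cs cmod_def power2_eq_square)
  have r: "y' $ 4 = s * y $ 7 - c * y $ 6" "y' $ 5 = s * y $ 6 + c * y $ 7"
    "y' $ 6 = c * y $ 4 - s * y $ 5" "y' $ 7 = - (s * y $ 4) - c * y $ 5"
    using \<zeta>(2,3) by (simp_all add: cs complex_eq_iff)
  have r': "- y $ 4 = s * y' $ 7 - c * y' $ 6" "- y $ 5 = s * y' $ 6 + c * y' $ 7"
    "- y $ 6 = c * y' $ 4 - s * y' $ 5" "- y $ 7 = - (s * y' $ 4) - c * y' $ 5"
    unfolding r using one by algebra+
  note S = cp_rot_exchange[OF \<zeta>(1)[unfolded cs]]
  have "cp_rot (exchange \<zeta>) y = y'" "cp_rot (exchange \<zeta>) y' = - y"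
    unfolding cs S vec_eq_8 by (simp_all add: vector_8 y y' r[symmetric] r'[symmetric])
  with \<zeta>(1) show thesis by (rule that)
qed

lemma span_axis_123: "{x :: real^8. \<forall>i. i \<notin> {1, 2, 3} \<longrightarrow> x $ i = 0} \<subseteq> span {axis 1 1, axis 2 1, axis 3 1}"
proof
  fix x :: "real^8" assume "x \<in> {x. \<forall>i. i \<notin> {1, 2, 3} \<longrightarrow> x $ i = 0}"
  then have "x = x $ 1 *\<^sub>R axis 1 1 + x $ 2 *\<^sub>R axis 2 1 + x $ 3 *\<^sub>R axis 3 1"
    by (auto simp: vec_eq_8 axis_def)
  also have "\<dots> \<in> span {axis 1 1, axis 2 1, axis 3 1}"
    by (intro span_add span_scale span_base) auto
  finally show "x \<in> span {axis 1 1, axis 2 1, axis 3 1}" .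
qed

text \<open>Commuting with \<open>\<Lambda>\<close> amounts to preserving every eigenspace. The
  phase is chosen to preserve the eigenspaces on axes 4 to 7.\<close>

lemma exchange_commutes:
  assumes eb: "orthonormal_eigenbasis \<Lambda> B ev" and e8: "\<Lambda> *v axis 8 1 = c *\<^sub>R axis 8 1"
    and d: "\<And>\<mu> i. i \<in> {1, 2, 3} \<Longrightarrow> (\<Sum>b | b \<in> B \<and> ev b = \<mu>. d_square b $ i) = 0"
    and four: "card {\<mu>. card {b \<in> B. ev b = \<mu>} = 1} \<ge> 4"
  obtains \<zeta> where "cmod \<zeta> = 1"
    "\<And>x. \<Lambda> *v cp_rot (exchange \<zeta>) x = cp_rot (exchange \<zeta>) (\<Lambda> *v x)"
proof -
  interpret orthonormal_eigenbasis \<Lambda> B ev by (rule eb)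
  note result = that
  note fin [simp] = finite_B
  \<comment> \<open>\<open>C b\<close> collects the basis vectors sharing the eigenvalue of
    \<open>b\<close>; \<open>N\<close> consists of the nondegenerate ones.\<close>
  define C where "C b = {a \<in> B. ev a = ev b}" for b
  define N where "N = {b \<in> B. card (C b) = 1}"
  have C_sub: "C b \<subseteq> B" for b by (auto simp: C_def)
  have finC [simp]: "finite (C b)" for b using finite_subset[OF C_sub] by simp
  have NB: "N \<subseteq> B" by (auto simp: N_def)
  have finN [simp]: "finite N" using finite_subset[OF NB] by simp
  have CN: "C b = {b}" if "b \<in> N" for b
  proof -
    have "b \<in> C b" using that by (simp add: C_def N_def)
    moreover have "card (C b) = 1" using that by (simp add: N_def)
    then obtain z where "C b = {z}" by (rule card_1_singletonE)
    ultimately show ?thesis by simp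
  qed
  have "{\<mu>. card {b \<in> B. ev b = \<mu>} = 1} \<subseteq> ev ` N"
  proof
    fix \<mu> assume "\<mu> \<in> {\<mu>. card {b \<in> B. ev b = \<mu>} = 1}"
    then have 1: "card {b \<in> B. ev b = \<mu>} = 1" by simp
    then obtain b where "{b \<in> B. ev b = \<mu>} = {b}" by (auto simp: card_1_singleton_iff)
    then have "b \<in> B" "ev b = \<mu>" by auto
    with 1 show "\<mu> \<in> ev ` N" by (auto simp: N_def C_def)
  qed
  then have "card {\<mu>. card {b \<in> B. ev b = \<mu>} = 1} \<le> card (ev ` N)"
    by (intro card_mono) simp_all
  also have "\<dots> \<le> card N" by (simp add: card_image_le)
  finally have N4: "card N \<ge> 4" using four by linarith
  have dC: "(\<Sum>a\<in>C b. d_square a $ i) = 0" if "i \<in> {1, 2, 3}" for b i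
    using d[OF that, of "ev b"] by (simp add: C_def)
  \<comment> \<open>Axis 8 is an eigenvector, so it has coordinates only along basis vectors with
    its eigenvalue. If one of these coordinates belongs to a nondegenerate \<open>b\<close>, there
    are no others.\<close>
  have axis8: "axis 8 1 = b $ 8 *\<^sub>R b" if "b \<in> N" "b $ 8 \<noteq> 0" for b
  proof -
    have b: "b \<in> B" using that NB by auto
    have ax: "axis 8 1 \<bullet> a = a $ 8" for a :: "real^8" by (simp add: inner_axis')
    have 0: "\<forall>a\<in>B. ev a \<noteq> c \<longrightarrow> a $ 8 = 0"
      using e8 unfolding eigenvector_iff ax .
    with b that have "ev b = c" by auto
    have "a $ 8 = 0" if "a \<in> B" "a \<noteq> b" for a
    proof (rule ccontr)
      assume "a $ 8 \<noteq> 0"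
      with 0 that have "a \<in> C b" by (auto simp: C_def \<open>ev b = c\<close>)
      with CN[OF \<open>b \<in> N\<close>] that show False by auto
    qed
    then show ?thesis
      using b by (intro eqI_B) (auto simp: ax inner_B)
  qed
  define E where "E = {b \<in> N. b $ 8 = 0}"
  have EN: "E \<subseteq> N" by (auto simp: E_def)
  have finE [simp]: "finite E" using finite_subset[OF EN] by simp
  have E47: "b $ 4 = 0" "b $ 5 = 0" "b $ 6 = 0" "b $ 7 = 0" "b $ 8 = 0" if "b \<in> E" for b
  proof -
    have b: "b \<in> N" "b $ 8 = 0" using that by (auto simp: E_def)
    have "d_square b $ i = 0" if "i \<in> {1, 2, 3}" for i
      using dC[OF that, of b] CN[OF b(1)] by simp
    from d_square_zero_components[OF b(2) this] b(2)
    show "b $ 4 = 0" "b $ 5 = 0" "b $ 6 = 0" "b $ 7 = 0" "b $ 8 = 0" by auto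
  qed
  define T where "T = {axis 1 1, axis 2 1, axis 3 1 :: real^8}"
  have "E \<subseteq> {x. \<forall>i. i \<notin> {1, 2, 3} \<longrightarrow> x $ i = 0}"
    unfolding forall_8 using E47 by auto
  then have ET: "E \<subseteq> span T" using span_axis_123 by (auto simp: T_def)
  have indE: "independent E"
    using independent_B EN NB by (meson independent_mono order_trans)
  have cT: "card T \<le> 3" unfolding T_def by (simp add: card_insert_if)
  have "card E \<le> card T"
    using independent_span_bound[OF _ indE ET] by (simp add: T_def)
  with cT have E3: "card E \<le> 3" by simp
  \<comment> \<open>At most three members of \<open>N\<close> fit into the span of axes 1 to 3, so
    one of the four or more has a component on axis 8.\<close>
  obtain b0 where b0: "b0 \<in> N" "b0 $ 8 \<noteq> 0"
  proof -
    have "N \<noteq> E" using N4 E3 by auto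
    then show thesis using that by (auto simp: E_def)
  qed
  have b0_comp: "b0 $ 1 = 0" "b0 $ 2 = 0" "b0 $ 3 = 0" "b0 $ 4 = 0" "b0 $ 5 = 0" "b0 $ 6 = 0" "b0 $ 7 = 0"
    using axis8[OF b0] b0(2) by (auto simp: vec_eq_8 axis_def)
  have N_eq: "N = insert b0 E"
  proof
    show "N \<subseteq> insert b0 E"
    proof
      fix b assume b: "b \<in> N"
      show "b \<in> insert b0 E"
      proof (cases "b $ 8 = 0")
        case False
        have "b \<bullet> b0 = b $ 8 * b0 $ 8" by (simp add: inner_8 b0_comp)
        then have "b \<bullet> b0 \<noteq> 0" using False b0 by simp
        moreover have "b \<in> B" "b0 \<in> B" using b b0 NB by auto
        ultimately show ?thesis using inner_B[of b b0] by (auto split: if_splits)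
      qed (use b in \<open>auto simp: E_def\<close>)
    qed
  qed (use b0 EN in auto)
  have "card N \<le> Suc (card E)" unfolding N_eq by (rule card_insert_le_m1) auto
  then have cE: "card E = 3" and cN: "card N = 4"
    using N4 E3 by auto
  \<comment> \<open>\<open>E\<close> consists of three independent vectors in a space of dimension
    at most three, so it spans axes 1 to 3. Whatever is orthogonal to \<open>E\<close> and
    \<open>b0\<close> then lives on axes 4 to 7.\<close>
  have spanE: "span T \<subseteq> span E"
  proof -
    have "dim (span T) \<le> card T" by (simp add: dim_le_card' T_def)
    then show ?thesis
      using card_ge_dim_independent[OF ET indE] cT cE by simp
  qed
  define Y where "Y = B - N"
  have cY: "card Y = 4"
    unfolding Y_def using card_Diff_subset[OF finN NB] cN card_B by simp
  have Y: "y $ 1 = 0" "y $ 2 = 0" "y $ 3 = 0" "y $ 8 = 0" if "y \<in> Y" for y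
  proof -
    have "orthogonal y x" if "x \<in> span T" for x
    proof (rule orthogonal_to_span)
      show "x \<in> span E" using that spanE by auto
      fix e assume "e \<in> E"
      then show "orthogonal y e"
        using \<open>y \<in> Y\<close> inner_B[of y e] subsetD[OF NB, of e] EN by (auto simp: orthogonal_def Y_def)
    qed
    then have T0: "y \<bullet> x = 0" if "x \<in> T" for x
      using span_base[OF that] by (simp add: orthogonal_def)
    then show "y $ 1 = 0" "y $ 2 = 0" "y $ 3 = 0"
      using T0[of "axis 1 1"] T0[of "axis 2 1"] T0[of "axis 3 1"]
      by (simp_all add: T_def inner_axis)
    have "y \<bullet> b0 = y $ 8 * b0 $ 8" by (simp add: inner_8 b0_comp)
    moreover have "y \<bullet> b0 = 0" using that inner_B[of y b0] b0 NB by (auto simp: Y_def)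
    ultimately show "y $ 8 = 0" using b0 by simp
  qed
  have CY: "C y \<subseteq> Y" if "y \<in> Y" for y
  proof
    fix a assume a: "a \<in> C y"
    then have "y \<in> C a" using that by (auto simp: C_def Y_def)
    then have "a \<in> N \<Longrightarrow> a = y" using CN[of a] by auto
    then show "a \<in> Y" using a that C_sub by (auto simp: Y_def)
  qed
  have C2: "card (C y) \<ge> 2" if "y \<in> Y" for y
  proof -
    have "y \<in> C y" using that by (auto simp: C_def Y_def)
    then have "card (C y) \<noteq> 0" by (auto simp only: card_eq_0_iff finC)
    moreover have "card (C y) \<noteq> 1" using that by (auto simp: Y_def N_def)
    ultimately show ?thesis by linarith
  qed
  \<comment> \<open>On \<open>E\<close> the exchange is -1 and it fixes \<open>b0\<close>, so only
    orthogonality between different eigenvalues within \<open>Y\<close> remains to be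
    supplied.\<close>
  have commute: thesis
    if \<zeta>: "cmod \<zeta> = 1"
      and inv: "\<And>y a. y \<in> Y \<Longrightarrow> a \<in> Y \<Longrightarrow> ev a \<noteq> ev y \<Longrightarrow> cp_rot (exchange \<zeta>) y \<bullet> a = 0" for \<zeta>
  proof -
    obtain p q where pq: "\<zeta> = Complex p q" by (cases \<zeta>)
    let ?S = "cp_rot (exchange \<zeta>)"
    note S = cp_rot_exchange[OF \<zeta>[unfolded pq], folded pq]
    have "\<Lambda> *v ?S b = ev b *\<^sub>R ?S b" if b: "b \<in> B" for b
    proof -
      consider "b \<in> E" | "b = b0" | "b \<in> Y" using b N_eq by (auto simp: Y_def)
      then show ?thesis
      proof cases
        case 1
        have "?S b = - b"
          unfolding S vec_eq_8 by (simp add: vector_8 E47[OF 1])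
        then show ?thesis using ev[OF b] by (simp add: linear_neg[OF matrix_vector_mul_linear])
      next
        case 2
        have "?S b = b"
          unfolding S vec_eq_8 by (simp add: vector_8 2 b0_comp)
        then show ?thesis using ev[OF b] by simp
      next
        case 3
        have "?S b \<bullet> a = 0" if a: "a \<in> B" "ev a \<noteq> ev b" for a
        proof -
          consider "a \<in> E" | "a = b0" | "a \<in> Y" using a N_eq by (auto simp: Y_def)
          then show ?thesis
          proof cases
            case 1
            then show ?thesis by (simp add: inner_8 S vector_8 E47 Y[OF 3])
          next
            case 2
            then show ?thesis by (simp add: inner_8 S vector_8 b0_comp Y[OF 3])
          next
            case A: 3
            then show ?thesis using inv[OF 3 A] a by simp
          qed
        qed
        then show ?thesis by (simp add: eigenvector_iff)
      qed
    qed
    moreover have "?S (\<Lambda> *v b) = ev b *\<^sub>R ?S b" if "b \<in> B" for b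
      by (simp add: ev[OF that] linear_scale[OF linear_cp_rot])
    ultimately have "\<And>b. b \<in> B \<Longrightarrow> (\<lambda>x. \<Lambda> *v ?S x) b = (\<lambda>x. ?S (\<Lambda> *v x)) b" by simp
    moreover have "linear (\<lambda>x. \<Lambda> *v ?S x)" "linear (\<lambda>x. ?S (\<Lambda> *v x))"
      using linear_compose[OF linear_cp_rot matrix_vector_mul_linear]
        linear_compose[OF matrix_vector_mul_linear linear_cp_rot] by (simp_all add: o_def)
    ultimately have "\<Lambda> *v ?S x = ?S (\<Lambda> *v x)" for x
      using linear_eq_on[where f = "\<lambda>x. \<Lambda> *v ?S x" and g = "\<lambda>x. ?S (\<Lambda> *v x)" and B = B and x = x]
        span_B by blast
    with \<zeta> show thesis by (rule result)
  qed
  obtain y0 where y0: "y0 \<in> Y" using cY by (metis card.empty equals0I zero_neq_numeral)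
  have finY: "finite Y" by (simp add: Y_def)
  show thesis
  proof (cases "C y0 = Y")
    case True
    \<comment> \<open>With a single eigenvalue on \<open>Y\<close> the orthogonality condition is
      vacuous, and any phase works.\<close>
    then have "ev a = ev y0" if "a \<in> Y" for a using that by (auto simp: C_def)
    then show ?thesis by (intro commute[of 1]) auto
  next
    case False
    then obtain y1 where y1: "y1 \<in> Y" "y1 \<notin> C y0" using CY[OF y0] by auto
    \<comment> \<open>Two disjoint classes with at least two vectors each, inside a set of four:
      both have exactly two and together they fill \<open>Y\<close>.\<close>
    have disj: "C y0 \<inter> C y1 = {}" using y1 by (auto simp: C_def Y_def)
    have un: "C y0 \<union> C y1 \<subseteq> Y" using CY y0 y1 by auto
    have sum: "card (C y0) + card (C y1) = card (C y0 \<union> C y1)"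
      using disj by (simp add: card_Un_disjoint)
    then have "card (C y0) + card (C y1) \<le> 4"
      using card_mono[OF finY un] cY by simp
    with C2[OF y0] C2[OF y1(1)] have c2: "card (C y0) = 2" "card (C y1) = 2" by auto
    have "card (C y0 \<union> C y1) = card Y" using sum c2 cY by simp
    then have un_eq: "C y0 \<union> C y1 = Y" using card_subset_eq[OF finY un] by simp
    obtain y y' where yy': "C y0 = {y, y'}" "y \<noteq> y'" using c2(1) by (auto simp: card_2_iff)
    have "y \<in> Y" "y' \<in> Y" using CY[OF y0] yy' by auto
    moreover have "norm y = 1" "norm y' = 1"
      using norm_B C_sub[of y0] yy' by auto
    moreover have "d_square y $ i + d_square y' $ i = 0" if "i \<in> {1, 2, 3}" for i
      using dC[OF that, of y0] yy' by simp
    ultimately obtain \<zeta> where \<zeta>: "cmod \<zeta> = 1" "cp_rot (exchange \<zeta>) y = y'" "cp_rot (exchange \<zeta>) y' = - y"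
      using exchange_maps_pair[of y y'] Y by metis
    have iso: "cp_rot (exchange \<zeta>) a \<bullet> cp_rot (exchange \<zeta>) b = a \<bullet> b" for a b
      by (rule inner_cp_rot[OF unitary_exchange[OF \<zeta>(1)]])
    show thesis
    proof (rule commute[OF \<zeta>(1)])
      fix b a assume ba: "b \<in> Y" "a \<in> Y" "ev a \<noteq> ev b"
      have YB: "Y \<subseteq> B" by (auto simp: Y_def)
      have evC: "ev x = ev y0" if "x \<in> C y0" for x using that by (simp add: C_def)
      have evC1: "ev x = ev y1" if "x \<in> C y1" for x using that by (simp add: C_def)
      show "cp_rot (exchange \<zeta>) b \<bullet> a = 0"
      proof (cases "b \<in> C y0")
        case True
        then have "a \<notin> C y0" using ba evC by metis
        then have "a \<noteq> y" "a \<noteq> y'" using yy' by auto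
        then have "y \<bullet> a = 0" "y' \<bullet> a = 0"
          using inner_B[of y a] inner_B[of y' a] subsetD[OF YB] ba \<open>y \<in> Y\<close> \<open>y' \<in> Y\<close> by simp_all
        moreover have "b = y \<or> b = y'" using True yy'(1) by blast
        ultimately show ?thesis by (elim disjE) (simp_all add: \<zeta>(2,3))
      next
        case False
        then have "ev b = ev y1" using un_eq ba(1) evC1 by blast
        then have "a \<notin> C y1" using ba(3) evC1[of a] by auto
        then have "a \<in> C y0" using un_eq ba(2) by blast
        \<comment> \<open>The isometry maps the plane of \<open>y\<close> and \<open>y'\<close> to
          itself, hence keeps vectors orthogonal to that plane orthogonal to it.\<close>
        have "b \<noteq> y" "b \<noteq> y'" using False yy' by auto
        then have "b \<bullet> y = 0" "b \<bullet> y' = 0"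
          using inner_B[of b y] inner_B[of b y'] subsetD[OF YB] ba \<open>y \<in> Y\<close> \<open>y' \<in> Y\<close> by simp_all
        then have "cp_rot (exchange \<zeta>) b \<bullet> y' = 0" "cp_rot (exchange \<zeta>) b \<bullet> y = 0"
          using iso[of b y] iso[of b y'] by (simp_all add: \<zeta>)
        then show ?thesis using \<open>a \<in> C y0\<close> yy' by auto
      qed
    qed
  qed
qed

section \<open>The CP4 symmetry\<close>

lemma K_vec_eigenbasis:
  assumes "orthonormal_eigenbasis \<Lambda> B ev"
  shows "K_vec \<Lambda> n = (\<Sum>b\<in>B. ev b ^ n *\<^sub>R d_square b)"
proof -
  have "(\<Sum>j\<in>UNIV. \<Sum>k\<in>UNIV. d_tensor i j k * mat_pow \<Lambda> n $ j $ k)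
      = (\<Sum>b\<in>B. ev b ^ n * (\<Sum>j\<in>UNIV. \<Sum>k\<in>UNIV. d_tensor i j k * b $ j * b $ k))" for i
    by (simp add: mat_pow_entry[OF assms] sum_distrib_left sum.swap[of _ B UNIV] mult_ac)
  then show ?thesis by (simp add: vec_eq_iff K_vec_def d_square_def)
qed

lemma su3_casimir: "(\<Sum>j\<in>UNIV. su3_gen j ** su3_gen j) = (4 / 3) *\<^sub>R mat 1"
proof -
  have "complex_of_real (sqrt 3) * complex_of_real (sqrt 3) = 3"
    by (simp flip: of_real_mult)
  then show ?thesis
    by (simp add: sum_8 su3_gen_def gell_mann_simps vec_eq_iff forall_3 matrix_matrix_mult_def sum_3
        mat_def scaleR_conv_of_real[where 'a = complex] field_simps)
qed

text \<open>The contraction of two indices of d is a trace of the quadratic Casimir times a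
  generator; the Casimir is scalar and generators are traceless. This supplies the zeroth moment,
  which is not among the alignment vectors.\<close>

lemma K_vec_0: "K_vec \<Lambda> 0 = 0"
proof -
  have "(\<Sum>k\<in>UNIV. d_tensor i j k * (mat 1 :: real^8^8) $ j $ k) = d_tensor i j j" for i j
    by (simp add: mat_def if_distrib cong: if_cong)
  moreover have "(\<Sum>j\<in>UNIV. d_tensor i j j) = 0" for i
  proof -
    have "d_tensor i j j = 4 * Re (trace (su3_gen j ** su3_gen j ** su3_gen i))" for j
    proof -
      have "trace (su3_gen i ** su3_gen j ** su3_gen j) = trace (su3_gen j ** su3_gen j ** su3_gen i)"
        by (rule trace_cyclic[symmetric])
      moreover have "trace (su3_gen j ** su3_gen i ** su3_gen j) = trace (su3_gen j ** su3_gen j ** su3_gen i)"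
        by (rule trace_cyclic)
      ultimately show ?thesis by (simp add: d_tensor_trace matrix_mult_add_left trace_add)
    qed
    then have "(\<Sum>j\<in>UNIV. d_tensor i j j) = 4 * Re (trace ((\<Sum>j\<in>UNIV. su3_gen j ** su3_gen j) ** su3_gen i))"
      by (simp add: sum_matrix_mult trace_sum sum_distrib_left)
    then show ?thesis
      by (simp add: su3_casimir scaleR_matrix_mult trace_scaleR trace_su3_gen)
  qed
  ultimately show ?thesis by (simp add: K_vec_def mat_pow_def vec_eq_iff)
qed

section \<open>Invariance of the potential and change of basis\<close>

lemma bilinear_potential_inner:
  "bilinear_potential M0 M \<Lambda>0 L \<Lambda> \<phi> = M0 * bilinear0 \<phi> + M \<bullet> bilinear \<phi> + \<Lambda>0 * (bilinear0 \<phi>)\<^sup>2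
    + bilinear0 \<phi> * (L \<bullet> bilinear \<phi>) + bilinear \<phi> \<bullet> (\<Lambda> *v bilinear \<phi>)"
  by (simp add: bilinear_potential_def inner_vec_def matrix_vector_mult_def sum_distrib_left mult_ac)

lemma cp_symmetry_bilinear_potential:
  assumes X: "unitary_mat X" and M: "cp_rot X M = M" and L: "cp_rot X L = L"
    and comm: "\<And>x. \<Lambda> *v cp_rot X x = cp_rot X (\<Lambda> *v x)"
  shows "cp_symmetry (bilinear_potential M0 M \<Lambda>0 L \<Lambda>) X"
proof -
  have inj: "inj (cp_rot X)"
  proof (rule injI)
    fix x y assume "cp_rot X x = cp_rot X y"
    then have "cp_rot X (x - y) = 0" by (simp add: linear_diff[OF linear_cp_rot])
    then show "x = y" using inner_cp_rot[OF X, of "x - y" "x - y"] by simp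
  qed
  have surj: "surj (cp_rot X)"
    by (rule linear_inj_imp_surj[OF linear_cp_rot inj])
  \<comment> \<open>\<open>cp_rot X\<close> is orthogonal and adjoint to the action of the CP map on
    bilinears, so it undoes that action; by surjectivity it suffices to test against its
    images.\<close>
  have inv: "cp_rot X (bilinear (cp_map X \<phi>)) = bilinear \<phi>" for \<phi>
  proof -
    have "cp_rot X (bilinear (cp_map X \<phi>)) \<bullet> y = bilinear \<phi> \<bullet> y" for y
    proof -
      obtain x where "y = cp_rot X x" using surj by auto
      then show ?thesis
        using inner_bilinear_cp_map[OF X, of x \<phi>] inner_cp_rot[OF X, of "bilinear (cp_map X \<phi>)" x]
        by (metis inner_commute)
    qed
    then show ?thesis using vector_eq_rdot by blast
  qed
  have "bilinear_potential M0 M \<Lambda>0 L \<Lambda> (cp_map X \<phi>) = bilinear_potential M0 M \<Lambda>0 L \<Lambda> \<phi>" for \<phi>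
  proof -
    let ?r = "bilinear (cp_map X \<phi>)"
    have "?r \<bullet> (\<Lambda> *v ?r) = cp_rot X (\<Lambda> *v ?r) \<bullet> bilinear \<phi>"
      using inner_bilinear_cp_map[OF X, of "\<Lambda> *v ?r" \<phi>] by (simp add: inner_commute)
    also have "\<dots> = bilinear \<phi> \<bullet> (\<Lambda> *v bilinear \<phi>)"
      by (simp add: comm[symmetric] inv inner_commute)
    finally show ?thesis
      by (simp add: bilinear_potential_inner bilinear0_cp_map X inner_bilinear_cp_map M L)
  qed
  with X show ?thesis by (simp add: cp_symmetry_def)
qed

text \<open>A basis change turns the CP matrix \<open>E\<close> into
  \<open>U ** E ** transpose U\<close> and conjugates its action by \<open>rot U\<close>. This
  carries a symmetry found in the aligned basis back to the original one.\<close>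

lemma cp_rot_conjugate:
  assumes U: "unitary_mat U" and E: "unitary_mat E"
  shows "cp_rot (U ** E ** transpose U) (rot U *v x) = rot U *v cp_rot E x"
proof -
  let ?X = "U ** E ** transpose U"
  have X: "unitary_mat ?X"
    by (intro unitary_mat_mult unitary_mat_transpose_unitary U E)
  have "herm_of (cp_rot ?X (rot U *v x)) = U ** transpose E ** (transpose U ** conj_mat U)
      ** transpose (herm_of x) ** (transpose U ** conj_mat U) ** conj_mat E ** adj U"
    by (simp add: herm_of_cp_rot X herm_of_rot U matrix_transpose_mul conj_mat_mult transpose_adj
        conj_mat_transpose matrix_mul_assoc)
  also have "\<dots> = U ** (transpose E ** transpose (herm_of x) ** conj_mat E) ** adj U"
    by (simp add: unitary_mat_transpose U matrix_mul_assoc)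
  also have "\<dots> = herm_of (rot U *v cp_rot E x)"
    by (simp add: herm_of_rot U herm_of_cp_rot E)
  finally show ?thesis by (simp only: herm_of_eq_iff)
qed

text \<open>The phase cancels in \<open>X ** conj_mat X\<close>, which is unitarily conjugate to the
  diagonal matrix with entries -1, -1, 1.\<close>

lemma cp_order4_exchange:
  assumes U: "unitary_mat U" and \<zeta>: "cmod \<zeta> = 1"
  shows "cp_order4 (U ** exchange \<zeta> ** transpose U)"
proof -
  let ?X = "U ** exchange \<zeta> ** transpose U" and ?D = "exchange \<zeta> ** conj_mat (exchange \<zeta>)"
  have \<zeta>': "\<zeta> * cnj \<zeta> = 1" using \<zeta> complex_norm_square[of \<zeta>] by simp
  have D: "?D = vector [vector [- 1, 0, 0], vector [0, - 1, 0], vector [0, 0, 1]]"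
    by (simp add: exchange_def conj_mat_def vec_eq_iff forall_3 matrix_matrix_mult_def sum_3 \<zeta>')
  have DD: "?D ** ?D = mat 1"
    unfolding D by (simp add: vec_eq_iff forall_3 matrix_matrix_mult_def sum_3 mat_def)
  have D1: "?D \<noteq> mat 1"
    unfolding D by (simp add: vec_eq_iff forall_3 mat_def)
  have "?X ** conj_mat ?X = U ** exchange \<zeta> ** (transpose U ** conj_mat U) ** conj_mat (exchange \<zeta>) ** adj U"
    by (simp add: conj_mat_mult conj_mat_transpose matrix_mul_assoc)
  then have XX: "?X ** conj_mat ?X = U ** ?D ** adj U"
    by (simp add: unitary_mat_transpose U matrix_mul_assoc)
  have "?X ** conj_mat ?X \<noteq> mat 1"
  proof
    assume "?X ** conj_mat ?X = mat 1"
    then have "adj U ** (U ** ?D ** adj U) ** U = adj U ** mat 1 ** U" by (simp only: XX)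
    then have "(adj U ** U) ** ?D ** (adj U ** U) = adj U ** U" by (simp add: matrix_mul_assoc)
    then show False using D1 by (simp add: unitary_mat_adj U)
  qed
  moreover have "(U ** ?D ** adj U) ** (U ** ?D ** adj U) = U ** (?D ** (adj U ** U) ** ?D) ** adj U"
    by (simp only: matrix_mul_assoc)
  then have "(?X ** conj_mat ?X) ** (?X ** conj_mat ?X) = mat 1"
    unfolding XX by (simp only: unitary_mat_adj U matrix_mul_rid DD)
  ultimately show ?thesis by (simp add: cp_order4_def)
qed

text \<open>Moves the spectral data to coordinates with the common direction on axis 8; eigenvalues
  are read off by rotating back.\<close>

lemma orthonormal_eigenbasis_rot:
  assumes U: "unitary_mat U" and eb: "orthonormal_eigenbasis \<Lambda> B ev"
  shows "orthonormal_eigenbasis (rot (adj U) ** \<Lambda> ** rot U) ((*v) (rot (adj U)) ` B) (\<lambda>x. ev (rot U *v x))"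
proof -
  interpret orthonormal_eigenbasis \<Lambda> B ev by (rule eb)
  note A = unitary_mat_adj_unitary[OF U]
  show ?thesis
  proof
    show "pairwise orthogonal ((*v) (rot (adj U)) ` B)"
      using orthogonal_B by (auto simp: pairwise_def orthogonal_def inner_rot_rot[OF A])
    show "norm b = 1" if "b \<in> (*v) (rot (adj U)) ` B" for b
      using that norm_B by (auto simp: norm_eq_1 inner_rot_rot[OF A])
    have "surj ((*v) (rot (adj U)))"
      using rot_adj_rot[OF U] by (metis surjI)
    then show "span ((*v) (rot (adj U)) ` B) = UNIV"
      by (simp add: linear_span_image[OF matrix_vector_mul_linear] span_B)
    show "(rot (adj U) ** \<Lambda> ** rot U) *v b = ev (rot U *v b) *\<^sub>R b" if "b \<in> (*v) (rot (adj U)) ` B" for b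
      using that by (auto simp: rot_rot_adj[OF U] ev matrix_vector_mult_scaleR
          simp flip: matrix_vector_mul_assoc)
  qed
qed

theorem theorem2:
  fixes V :: "higgs_fields \<Rightarrow> real"
    and M0 \<Lambda>0 :: real and M L :: "real^8" and \<Lambda> :: "real^8^8"
  assumes "is_3hdm_potential V"
    and "V = bilinear_potential M0 M \<Lambda>0 L \<Lambda>"
    and "transpose \<Lambda> = \<Lambda>"
    and "\<exists>v\<in>alignment_vectors M L \<Lambda>. v \<noteq> 0"
    and "complete_alignment M L \<Lambda>"
    and "card (nondegenerate_eigenvalues \<Lambda>) \<ge> 4"
  shows "has_CP4 V"
proof -
  obtain n where n: "n \<in> alignment_vectors M L \<Lambda>" "n \<noteq> 0" using assms(4) by blast
  then have "self_aligned n" and "\<exists>c. \<Lambda> *v n = c *\<^sub>R n"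
    and par: "\<And>v. v \<in> alignment_vectors M L \<Lambda> \<Longrightarrow> v \<noteq> 0 \<Longrightarrow> parallel n v"
    using assms(5) by (auto simp: complete_alignment_def)
  then obtain c where c: "\<Lambda> *v n = c *\<^sub>R n" by blast
  have "parallel n (d_square n)"
    using \<open>self_aligned n\<close> by (simp add: self_aligned_def parallel_def d_square_def insert_commute)
  \<comment> \<open>The default \<open>\<beta> = 0\<close> covers the case that
    \<open>d_square n\<close> vanishes.\<close>
  then obtain \<beta> where "d_square n = \<beta> *\<^sub>R n"
    using n by (auto simp: parallel_def collinear_lemma intro: that[of 0])
  then obtain U k where U: "unitary_mat U" and k: "n = k *\<^sub>R (rot U *v axis 8 1)"
    using self_aligned_rot[OF n(2)] by blast
  define u where "u = rot U *v axis 8 1"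
  have k0: "k \<noteq> 0" using k n by auto
  have av: "\<exists>h. v = h *\<^sub>R u" if "v \<in> alignment_vectors M L \<Lambda>" for v
  proof (cases "v = 0")
    case False
    then show ?thesis
      using par[OF that] n unfolding parallel_def collinear_lemma k u_def by auto
  qed (auto intro: exI[of _ 0])
  have \<Lambda>u: "\<Lambda> *v u = c *\<^sub>R u"
  proof (rule scaleR_left_imp_eq[OF k0])
    show "k *\<^sub>R (\<Lambda> *v u) = k *\<^sub>R (c *\<^sub>R u)"
      using c unfolding k u_def[symmetric] by (simp add: matrix_vector_mult_scaleR mult.commute)
  qed
  obtain B ev where eb: "orthonormal_eigenbasis \<Lambda> B ev"
    using symmetric_matrix_eigenbasis_exists[OF assms(3)] .
  interpret orthonormal_eigenbasis \<Lambda> B ev by (rule eb)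
  let ?R = "rot U" and ?Q = "rot (adj U)"
  define \<Lambda>' where "\<Lambda>' = ?Q ** \<Lambda> ** ?R"
  have \<Lambda>': "?R *v (\<Lambda>' *v x) = \<Lambda> *v (?R *v x)" for x
    by (simp add: \<Lambda>'_def rot_rot_adj[OF U] flip: matrix_vector_mul_assoc)
  have inj: "inj_on ((*v) ?Q) A" for A
    by (metis inj_onI rot_rot_adj[OF U])
  have class_eq: "{b \<in> (*v) ?Q ` B. ev (?R *v b) = \<mu>} = (*v) ?Q ` {b \<in> B. ev b = \<mu>}" for \<mu>
    by (auto simp: rot_rot_adj[OF U])
  \<comment> \<open>The bound means exponents 0 to 7: \<open>K_vec_0\<close> covers 0, alignment
    covers 1 to 7. Since all these vectors are multiples of \<open>u\<close>, they vanish against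
    any \<open>w\<close> orthogonal to \<open>u\<close>.\<close>
  have moments: "(\<Sum>b\<in>B. ev b ^ m * (d_square b \<bullet> w)) = 0" if "u \<bullet> w = 0" "m < card B" for w m
  proof -
    have "\<exists>h. K_vec \<Lambda> m = h *\<^sub>R u"
    proof (cases "m = 0")
      case True
      then show ?thesis by (auto simp: K_vec_0 intro: exI[of _ 0])
    next
      case False
      then show ?thesis
        using that(2) by (intro av) (auto simp: alignment_vectors_def card_B)
    qed
    then have "K_vec \<Lambda> m \<bullet> w = 0" using that(1) by auto
    then show ?thesis by (simp add: K_vec_eigenbasis[OF eb] inner_sum_left)
  qed
  have sums: "(\<Sum>b | b \<in> (*v) ?Q ` B \<and> ev (?R *v b) = \<mu>. d_square b $ i) = 0"
    if "i \<in> {1, 2, 3}" for \<mu> i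
  proof -
    \<comment> \<open>The first three axes are orthogonal to axis 8, so their rotated images are
      admissible test vectors for \<open>moments\<close>.\<close>
    define w where "w = ?R *v axis i 1"
    have "u \<bullet> w = axis 8 1 \<bullet> (axis i 1 :: real^8)"
      by (simp add: u_def w_def inner_rot_rot[OF U])
    also have "\<dots> = 0" using that by (auto simp: inner_axis_axis)
    finally have uw: "u \<bullet> w = 0" .
    have "d_square (?Q *v b) $ i = d_square b \<bullet> w" for b
      using inner_d_square_rot[OF unitary_mat_adj_unitary[OF U], of b w]
      by (simp add: w_def rot_adj_rot[OF U] inner_axis)
    then have "(\<Sum>b | b \<in> (*v) ?Q ` B \<and> ev (?R *v b) = \<mu>. d_square b $ i)
        = (\<Sum>b | b \<in> B \<and> ev b = \<mu>. d_square b \<bullet> w)"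
      unfolding class_eq by (simp add: sum.reindex[OF inj])
    also have "\<dots> = 0"
      by (rule vanishing_moments[OF finite_B moments[OF uw]])
    finally show ?thesis .
  qed
  have "\<Lambda>' *v axis 8 1 = c *\<^sub>R axis 8 1"
    unfolding \<Lambda>'_def using \<Lambda>u
    by (simp add: u_def matrix_vector_mult_scaleR rot_adj_rot[OF U] flip: matrix_vector_mul_assoc)
  moreover have "card {\<mu>. card {b \<in> (*v) ?Q ` B. ev (?R *v b) = \<mu>} = 1} \<ge> 4"
    using assms(6) unfolding class_eq card_image[OF inj] nondegenerate_eigenvalues_def dim_eigenspace .
  ultimately obtain \<zeta> where \<zeta>: "cmod \<zeta> = 1"
    "\<And>x. \<Lambda>' *v cp_rot (exchange \<zeta>) x = cp_rot (exchange \<zeta>) (\<Lambda>' *v x)"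
    using exchange_commutes[OF orthonormal_eigenbasis_rot[OF U eb, folded \<Lambda>'_def] _ sums] by metis
  let ?X = "U ** exchange \<zeta> ** transpose U"
  note E = unitary_exchange[OF \<zeta>(1)]
  have X: "unitary_mat ?X"
    by (intro unitary_mat_mult unitary_mat_transpose_unitary U E)
  have "cp_rot (exchange \<zeta>) (axis 8 1) = axis 8 1"
    using cp_rot_exchange[of "Re \<zeta>" "Im \<zeta>"] \<zeta>(1) by (simp add: vec_eq_8 vector_8 axis_def)
  then have "cp_rot ?X u = u"
    by (simp add: u_def cp_rot_conjugate[OF U E])
  then have fix_av: "cp_rot ?X v = v" if "v \<in> alignment_vectors M L \<Lambda>" for v
    using av[OF that] by (auto simp: linear_scale[OF linear_cp_rot])
  have "\<Lambda> *v cp_rot ?X x = cp_rot ?X (\<Lambda> *v x)" for x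
  proof -
    define y where "y = ?Q *v x"
    have x: "x = ?R *v y" by (simp add: y_def rot_rot_adj[OF U])
    show ?thesis
      unfolding x by (simp add: cp_rot_conjugate[OF U E] \<zeta>(2) flip: \<Lambda>')
  qed
  then have "cp_symmetry V ?X"
    unfolding assms(2) using X fix_av
    by (intro cp_symmetry_bilinear_potential) (auto simp: alignment_vectors_def)
  with cp_order4_exchange[OF U \<zeta>(1)] show ?thesis by (auto simp: has_CP4_def)
qed

end
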